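(* Let $g_0$ be a round metric of curvature one on $\mathbb{S}^2$. Then for any admissible measure $\mu$ on $\mathbb{S}^2$ such that $\lambda_1(\mathbb{S}^2,\mu)=2$, there exists a conformal automorphism $\Phi$ of $\mathbb{S}^2$ such that $$8\pi-\bar\lambda_1(\mathbb{S}^2,\mu)\;\geqslant\; 2\,\|\Phi_*\mu-dv_{g_0}\|^2_{W^{-1,2}(\mathbb{S}^2,g_0)}.$$
   Context: A nonzero (nonnegative) Radon measure $\mu$ on $\mathbb{S}^2$ is called admissible if the identity map on $C^\infty(\mathbb{S}^2)$ extends to a compact operator $W^{1,2}(\mathbb{S}^2,g_0)\to L^2(\mathbb{S}^2,\mu)$. For an admissible measure, $$\lambda_k(\mathbb{S}^2,\mu)=\inf_{E_{k+1}}\ \sup_{0\neq f\in E_{k+1}}\frac{\int_{\mathbb{S}^2}|\nabla f|^2_{g_0}\,dv_{g_0}}{\int_{\mathbb{S}^2}f^2\,d\mu},$$ the infimum being over all $(k+1)$-dimensional subspaces $E_{k+1}\subset C^\infty(\mathbb{S}^2)$ which are also $(k+1)$-dimensional in $L^2(\mathbb{S}^2,\mu)$; and $\bar\lambda_k(\mathbb{S}^2,\mu)=\lambda_k(\mathbb{S}^2,\mu)\,\mu(\mathbb{S}^2)$. Here $dv_{g_0}$ is the Riemannian area measure of $g_0$, and $\Phi_*\mu$ is the push-forward measure. For a (signed) Radon measure $\sigma$, $\|\sigma\|_{W^{-1,2}(\mathbb{S}^2,g_0)}=\sup\{\int f\,d\sigma: f\in C^\infty(\mathbb{S}^2),\ \|f\|_{W^{1,2}(\mathbb{S}^2,g_0)}=1\}$,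 with $\|f\|^2_{W^{1,2}(\mathbb{S}^2,g_0)}=\int(|df|_{g_0}^2+f^2)\,dv_{g_0}$. *)

theory Defs
  imports "HOL-Analysis.Analysis"
begin

text \<open>
  The 2-sphere with its round metric of curvature one is the unit sphere of \<open>real ^ 3\<close> with the
  induced metric. A function on the sphere is given by any function on \<open>real ^ 3\<close>; its values off
  the sphere are irrelevant for all notions below.
\<close>

abbreviation S2 :: "(real ^ 3) set" where
  "S2 \<equiv> sphere 0 1"

text \<open>\<open>C\<^sup>k\<close> maps on an open set, by recursion through the partial derivatives.\<close>

primrec Ck_on :: "nat \<Rightarrow> ('a::euclidean_space \<Rightarrow> 'b::real_normed_vector) \<Rightarrow> 'a set \<Rightarrow> bool" where
  "Ck_on 0 F U \<longleftrightarrow> continuous_on U F"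
| "Ck_on (Suc k) F U \<longleftrightarrow>
     F differentiable_on U \<and> (\<forall>i\<in>Basis. Ck_on k (\<lambda>x. frechet_derivative F (at x) i) U)"

text \<open>
  The extension of a map on the sphere that is constant along rays, i.e. its pullback under the
  smooth retraction \<open>x \<mapsto> x / \<parallel>x\<parallel>\<close> of the punctured space onto the sphere. The map is smooth
  on the sphere iff this pullback is smooth. The derivative of the pullback at a point \<open>x\<close> of
  the sphere vanishes in the direction \<open>x\<close> and is the intrinsic differential on the tangent
  space \<open>{v. v \<bullet> x = 0}\<close>; so the Euclidean gradient of the pullback at \<open>x\<close> is the
  Riemannian gradient.
\<close>

definition radial :: "(real ^ 3 \<Rightarrow> 'b) \<Rightarrow> real ^ 3 \<Rightarrow> 'b" where
  "radial f x = f (x /\<^sub>R norm x)"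

definition smooth_S2 :: "(real ^ 3 \<Rightarrow> 'b::real_normed_vector) \<Rightarrow> bool" where
  "smooth_S2 f \<longleftrightarrow> (\<forall>k. Ck_on k (radial f) (- {0}))"

definition diff_S2 :: "(real ^ 3 \<Rightarrow> 'b::real_normed_vector) \<Rightarrow> real ^ 3 \<Rightarrow> real ^ 3 \<Rightarrow> 'b" where
  "diff_S2 f x = frechet_derivative (radial f) (at x)"

definition grad_S2 :: "(real ^ 3 \<Rightarrow> real) \<Rightarrow> real ^ 3 \<Rightarrow> real ^ 3" where
  "grad_S2 f x = (THE D. GDERIV (radial f) x :> D)"

text \<open>The smooth maps with smooth inverse that pull the round metric back to \<open>\<rho>\<close> times itself,
  \<open>\<rho> > 0\<close>. They may reverse orientation.\<close>

definition conformal_automorphism :: "(real ^ 3 \<Rightarrow> real ^ 3) \<Rightarrow> bool" where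
  "conformal_automorphism \<Phi> \<longleftrightarrow>
     bij_betw \<Phi> S2 S2 \<and> smooth_S2 \<Phi> \<and> smooth_S2 (inv_into S2 \<Phi>) \<and>
     (\<forall>x\<in>S2. \<exists>\<rho>>0. \<forall>v w. v \<bullet> x = 0 \<longrightarrow> w \<bullet> x = 0 \<longrightarrow>
        diff_S2 \<Phi> x v \<bullet> diff_S2 \<Phi> x w = \<rho> * (v \<bullet> w))"

abbreviation borel_S2 :: "(real ^ 3) measure" where
  "borel_S2 \<equiv> restrict_space borel S2"

text \<open>
  The Riemannian area measure in the polar coordinates \<open>(\<theta>, \<phi>)\<close>, in which the round metric is
  \<open>d\<theta>\<^sup>2 + sin\<^sup>2 \<theta> d\<phi>\<^sup>2\<close>, so that the density \<open>sqrt (det g)\<close> is \<open>sin \<theta>\<close>. This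
  chart omits only a half great circle, which is a null set.
\<close>

definition polar :: "real \<times> real \<Rightarrow> real ^ 3" where
  "polar = (\<lambda>(\<theta>, \<phi>). vector [sin \<theta> * cos \<phi>, sin \<theta> * sin \<phi>, cos \<theta>])"

definition area_S2 :: "(real ^ 3) measure" where
  "area_S2 =
     distr (density (restrict_space lborel ({0..pi} \<times> {0..2 * pi})) (\<lambda>(\<theta>, \<phi>). ennreal (sin \<theta>)))
       borel_S2 polar"

text \<open>On the compact metric space \<open>S2\<close> the nonnegative Radon measures are the finite Borel measures.\<close>

definition nonzero_radon_S2 :: "(real ^ 3) measure \<Rightarrow> bool" where
  "nonzero_radon_S2 M \<longleftrightarrow> sets M = sets borel_S2 \<and> finite_measure M \<and> emeasure M S2 \<noteq> 0"

definition pushforward_S2 :: "(real ^ 3 \<Rightarrow> real ^ 3) \<Rightarrow> (real ^ 3) measure \<Rightarrow> (real ^ 3) measure" where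
  "pushforward_S2 \<Phi> M = distr M borel_S2 \<Phi>"

definition L2 :: "'a measure \<Rightarrow> ('a \<Rightarrow> 'b::euclidean_space) set" where
  "L2 M = {f \<in> borel_measurable M. integrable M (\<lambda>x. (norm (f x))\<^sup>2)}"

definition L2_norm :: "'a measure \<Rightarrow> ('a \<Rightarrow> 'b::euclidean_space) \<Rightarrow> real" where
  "L2_norm M f = sqrt (\<integral>x. (norm (f x))\<^sup>2 \<partial>M)"

type_synonym sobolev = "(real ^ 3 \<Rightarrow> real) \<times> (real ^ 3 \<Rightarrow> real ^ 3)"

definition W12_norm :: "sobolev \<Rightarrow> real" where
  "W12_norm = (\<lambda>(u, G). sqrt (\<integral>x. ((norm (G x))\<^sup>2 + (u x)\<^sup>2) \<partial>area_S2))"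

definition jet :: "(real ^ 3 \<Rightarrow> real) \<Rightarrow> sobolev" where
  "jet f = (f, grad_S2 f)"

text \<open>
  The Sobolev space \<open>W\<^sup>1\<^sup>,\<^sup>2\<close> is the completion of the smooth functions under their
  \<open>W\<^sup>1\<^sup>,\<^sup>2\<close> norm, realised as the closure of the pairs \<open>(f, \<nabla>f)\<close> in
  \<open>L\<^sup>2 \<oplus> L\<^sup>2\<close>; its elements are represented by pairs of a function and its weak
  gradient, with pairs at distance zero describing the same element.
\<close>

definition W12 :: "sobolev set" where
  "W12 = {(u, G). u \<in> L2 area_S2 \<and> G \<in> L2 area_S2 \<and>
     (\<exists>f. (\<forall>n::nat. smooth_S2 (f n)) \<and>
       (\<lambda>n. W12_norm (\<lambda>x. u x - f n x, \<lambda>x. G x - grad_S2 (f n) x)) \<longlonglongrightarrow> 0)}"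

text \<open>
  Compact linear operators from the Sobolev space to \<open>L\<^sup>2(M)\<close>, both given by representatives.
  Linearity holds modulo null functions. Compactness implies boundedness, and hence that
  representatives of one element of the Sobolev space have the same image in \<open>L\<^sup>2(M)\<close>.
\<close>

definition compact_operator_W12_L2 :: "(real ^ 3) measure \<Rightarrow> (sobolev \<Rightarrow> real ^ 3 \<Rightarrow> real) \<Rightarrow> bool" where
  "compact_operator_W12_L2 M T \<longleftrightarrow>
     (\<forall>w\<in>W12. T w \<in> L2 M) \<and>
     (\<forall>u G u' G'. (u, G) \<in> W12 \<longrightarrow> (u', G') \<in> W12 \<longrightarrow>
        (AE x in M. T (\<lambda>y. u y + u' y, \<lambda>y. G y + G' y) x = T (u, G) x + T (u', G') x)) \<and>
     (\<forall>c u G. (u, G) \<in> W12 \<longrightarrow>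
        (AE x in M. T (\<lambda>y. c * u y, \<lambda>y. c *\<^sub>R G y) x = c * T (u, G) x)) \<and>
     (\<forall>w. (\<forall>n::nat. w n \<in> W12) \<longrightarrow> bounded (range (\<lambda>n. W12_norm (w n))) \<longrightarrow>
        (\<exists>r h. strict_mono (r :: nat \<Rightarrow> nat) \<and> h \<in> L2 M \<and>
           (\<lambda>n. L2_norm M (\<lambda>x. T (w (r n)) x - h x)) \<longlonglongrightarrow> 0))"

definition admissible :: "(real ^ 3) measure \<Rightarrow> bool" where
  "admissible M \<longleftrightarrow> nonzero_radon_S2 M \<and>
     (\<exists>T. compact_operator_W12_L2 M T \<and>
        (\<forall>f. smooth_S2 f \<longrightarrow> (AE x in M. T (jet f) x = f x)))"

definition linear_subspace :: "('a \<Rightarrow> real) set \<Rightarrow> bool" where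
  "linear_subspace E \<longleftrightarrow> (\<lambda>x. 0) \<in> E \<and> (\<forall>f\<in>E. \<forall>g\<in>E. (\<lambda>x. f x + g x) \<in> E) \<and>
     (\<forall>c. \<forall>f\<in>E. (\<lambda>x. c * f x) \<in> E)"

text \<open>
  A linear subspace \<open>E\<close> has dimension \<open>d\<close> after identifying functions that differ by a function
  satisfying \<open>null\<close>: the members \<open>b 0, \<dots>, b (d - 1)\<close> of \<open>E\<close> form a basis of the image.
  With \<open>null\<close> meaning zero on the sphere this is the dimension as a space of functions on the
  sphere; with \<open>null\<close> meaning zero almost everywhere it is the dimension in \<open>L\<^sup>2\<close>.
\<close>

definition has_dim_mod :: "(('a \<Rightarrow> real) \<Rightarrow> bool) \<Rightarrow> nat \<Rightarrow> ('a \<Rightarrow> real) set \<Rightarrow> bool" where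
  "has_dim_mod null d E \<longleftrightarrow>
     (\<exists>b. (\<forall>i<d. b i \<in> E) \<and>
        (\<forall>c. null (\<lambda>x. \<Sum>i<d. c i * b i x) \<longrightarrow> (\<forall>i<d. c i = 0)) \<and>
        (\<forall>f\<in>E. \<exists>c. null (\<lambda>x. f x - (\<Sum>i<d. c i * b i x))))"

definition test_spaces :: "nat \<Rightarrow> (real ^ 3) measure \<Rightarrow> (real ^ 3 \<Rightarrow> real) set set" where
  "test_spaces d M = {E. E \<subseteq> {f. smooth_S2 f} \<and> linear_subspace E \<and>
     has_dim_mod (\<lambda>f. \<forall>x\<in>S2. f x = 0) d E \<and> has_dim_mod (\<lambda>f. AE x in M. f x = 0) d E}"

definition eigenvalue_S2 :: "nat \<Rightarrow> (real ^ 3) measure \<Rightarrow> ereal" where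
  "eigenvalue_S2 k M =
     (INF E \<in> test_spaces (k + 1) M. SUP f \<in> {f \<in> E. \<exists>x\<in>S2. f x \<noteq> 0}.
        ereal ((\<integral>x. (norm (grad_S2 f x))\<^sup>2 \<partial>area_S2) / (\<integral>x. (f x)\<^sup>2 \<partial>M)))"

definition normalized_eigenvalue_S2 :: "nat \<Rightarrow> (real ^ 3) measure \<Rightarrow> ereal" where
  "normalized_eigenvalue_S2 k M = eigenvalue_S2 k M * ereal (measure M S2)"

text \<open>
  The \<open>W\<^sup>-\<^sup>1\<^sup>,\<^sup>2\<close> norm of the signed measure \<open>M - N\<close>, for finite measures \<open>M\<close> and
  \<open>N\<close>; every signed Radon measure on the sphere is such a difference. The value may be infinite.
\<close>

definition dual_norm_diff :: "(real ^ 3) measure \<Rightarrow> (real ^ 3) measure \<Rightarrow> ereal" where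
  "dual_norm_diff M N =
     (SUP f \<in> {f. smooth_S2 f \<and> W12_norm (jet f) = 1}. ereal ((\<integral>x. f x \<partial>M) - (\<integral>x. f x \<partial>N)))"

end

theory Submission
  imports Defs
begin

text \<open>
  Since \<open>\<lambda>\<^sub>1 = 2\<close>, every smooth \<open>u\<close> satisfies \<open>\<integral>|\<nabla>u|\<^sup>2 \<ge> 2 Var(u)\<close>, where
  \<open>Var(u) = \<integral>u\<^sup>2 d\<mu> - (\<integral>u d\<mu>)\<^sup>2 / \<mu>(S2)\<close>. Tested against logarithmic cutoffs this excludes
  atoms, so Hersch's argument gives a Moebius map \<open>\<Phi>\<close> for which \<open>\<nu> = \<Phi>\<^sub>*\<mu>\<close> has its centre of mass
  at the origin; as the Dirichlet energy is conformally invariant, \<open>\<nu>\<close> satisfies the same inequality.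
  For smooth \<open>h\<close> the functions \<open>x\<^sub>i h\<close> have total energy \<open>\<integral>|\<nabla>h|\<^sup>2 + 2 h\<^sup>2 dA\<close>, because
  \<open>\<Sum> x\<^sub>i\<^sup>2 = 1\<close> and \<open>\<Sum> |\<nabla>x\<^sub>i|\<^sup>2 = 2\<close>. Given \<open>f\<close> with \<open>W\<^sup>1\<^sup>,\<^sup>2\<close> norm one, put
  \<open>d = \<integral>f d\<nu> - \<integral>f dA\<close> and \<open>h = 1 + d f\<close>. Summing the inequality over \<open>x\<^sub>i h\<close>, the terms
  \<open>\<integral>f\<^sup>2 d\<nu>\<close> cancel against the means by the Cauchy-Schwarz inequality, and what is left is
  \<open>2 d\<^sup>2 \<le> 8 \<pi> - 2 \<nu>(S2)\<close>.
\<close>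

section \<open>Smooth maps\<close>

text \<open>The coefficient of f in h comes from an optimisation. With h = 1 + t f the summed
  inequality reads 4 t d \<le> 8 \<pi> - 2 \<nu>(S2) + t^2 (E(f) + 2 \<integral>f^2 dA), E being the
  Dirichlet energy. For f of norm one the bracket is at most 2, and 4 t d - 2 t^2 is largest at t =
  d, with value 2 d^2. Balancing \<nu> makes the mean of x_i h linear in t, so that its square
  carries the same factor t^2 as the term in f^2. Since \<Phi> depends on \<mu> alone, the bound
  holds for all f at once. Two points shape the rest. \<open>area_S2\<close> is given in one polar
  chart, in which rotations and Moebius maps look complicated; integrals over the sphere are
  therefore turned into integrals over the unit ball, where the Euclidean change of variables
  applies. And no eigenvalue of \<nu> is ever computed: only the inequality for smooth functions is
  transported.\<close>

lemma Ck_on_cong: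
  assumes "open U" "\<And>x. x \<in> U \<Longrightarrow> F x = G x" "Ck_on k F U"
  shows "Ck_on k G U"
  using assms(2,3)
proof (induction k arbitrary: F G)
  case 0
  then show ?case by (metis Ck_on.simps(1) continuous_on_cong)
next
  case (Suc k)
  have eq: "frechet_derivative F (at x) = frechet_derivative G (at x)" if x: "x \<in> U" for x
  proof (rule frechet_derivative_transform_within_open[OF _ \<open>open U\<close> x Suc.prems(1)])
    show "F differentiable at x"
      using Suc.prems(2) x \<open>open U\<close> by (simp add: differentiable_on_eq_differentiable_at)
  qed
  have "G differentiable_on U"
    unfolding differentiable_on_def
  proof
    fix x assume x: "x \<in> U"
    then obtain D where "(F has_derivative D) (at x within U)"
      using Suc.prems(2) by (auto simp: differentiable_on_def differentiable_def)
    then have "(G has_derivative D) (at x within U)"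
      by (rule has_derivative_transform[OF x, rotated]) (simp add: Suc.prems(1))
    then show "G differentiable (at x within U)"
      by (rule differentiableI)
  qed
  moreover have "Ck_on k (\<lambda>x. frechet_derivative G (at x) i) U" if "i \<in> Basis" for i
    using Suc.IH[of "\<lambda>x. frechet_derivative F (at x) i"] eq Suc.prems(2) that by auto
  ultimately show ?case by auto
qed

text \<open>\<open>Ck_on\<close> is stated with the choice operator
  \<open>frechet_derivative\<close>; uniqueness of the derivative lets any explicit formula
  \<open>F'\<close> take its place. The closure properties below rest on this form.\<close>

lemma Ck_on_SucI:
  assumes "open U" "\<And>x. x \<in> U \<Longrightarrow> (F has_derivative F' x) (at x)"
    "\<And>i. i \<in> Basis \<Longrightarrow> Ck_on k (\<lambda>x. F' x i) U"
  shows "Ck_on (Suc k) F U"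
proof -
  have "F differentiable_on U"
    using assms(1,2) by (auto simp: differentiable_on_eq_differentiable_at intro: differentiableI)
  moreover have "Ck_on k (\<lambda>x. frechet_derivative F (at x) i) U" if "i \<in> Basis" for i
  proof (rule Ck_on_cong[OF assms(1) _ assms(3)[OF that]])
    show "F' x i = frechet_derivative F (at x) i" if "x \<in> U" for x
      using frechet_derivative_at[OF assms(2)[OF that]] by simp
  qed
  ultimately show ?thesis by auto
qed

lemma Ck_on_Suc_derivative:
  assumes "open U" "Ck_on (Suc k) F U" "x \<in> U"
  shows "(F has_derivative frechet_derivative F (at x)) (at x)"
  using assms by (simp add: differentiable_on_eq_differentiable_at frechet_derivative_works)

lemma Ck_on_Suc_imp: "Ck_on (Suc k) F U \<Longrightarrow> Ck_on k F U"
  by (induction k arbitrary: F) (auto simp: differentiable_imp_continuous_on)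

lemma Ck_on_const: "open U \<Longrightarrow> Ck_on k (\<lambda>x. c) U"
proof (induction k arbitrary: c)
  case (Suc k)
  then show ?case by (intro Ck_on_SucI[where F' = "\<lambda>x v. 0"]) auto
qed auto

lemma Ck_on_bounded_linear:
  assumes "open U" "bounded_linear L" "Ck_on k F U"
  shows "Ck_on k (\<lambda>x. L (F x)) U"
  using assms(3)
proof (induction k arbitrary: F)
  case 0
  then show ?case using assms(2) by (auto intro: bounded_linear.continuous_on)
next
  case (Suc k)
  show ?case
  proof (rule Ck_on_SucI[OF assms(1)])
    show "((\<lambda>x. L (F x)) has_derivative (\<lambda>v. L (frechet_derivative F (at x) v))) (at x)" if "x \<in> U" for x
      using bounded_linear.has_derivative[OF assms(2) Ck_on_Suc_derivative[OF assms(1) Suc.prems that]] .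
  qed (use Suc in auto)
qed

lemma Ck_on_id: "open U \<Longrightarrow> Ck_on k (\<lambda>x. x) U"
  by (cases k) (auto intro!: Ck_on_SucI[where F' = "\<lambda>x v. v"] Ck_on_const simp del: Ck_on.simps(2))

lemma Ck_on_add:
  assumes "open U" "Ck_on k F U" "Ck_on k G U"
  shows "Ck_on k (\<lambda>x. F x + G x) U"
  using assms(2,3)
proof (induction k arbitrary: F G)
  case 0
  then show ?case by (auto intro: continuous_intros)
next
  case (Suc k)
  show ?case
  proof (rule Ck_on_SucI[OF assms(1)])
    show "((\<lambda>x. F x + G x) has_derivative
       (\<lambda>v. frechet_derivative F (at x) v + frechet_derivative G (at x) v)) (at x)" if "x \<in> U" for x
      using has_derivative_add[OF Ck_on_Suc_derivative[OF assms(1) Suc.prems(1) that]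
         Ck_on_Suc_derivative[OF assms(1) Suc.prems(2) that]] .
  qed (use Suc in auto)
qed

lemma Ck_on_sum:
  assumes "open U" "\<And>i. i \<in> I \<Longrightarrow> Ck_on k (F i) U"
  shows "Ck_on k (\<lambda>x. \<Sum>i\<in>I. F i x) U"
  using assms(2) by (induction I rule: infinite_finite_induct) (auto intro: Ck_on_add Ck_on_const assms(1))

lemma Ck_on_scaleR:
  assumes "open U" "Ck_on k f U" "Ck_on k G U"
  shows "Ck_on k (\<lambda>x. f x *\<^sub>R G x) U"
  using assms(2,3)
proof (induction k arbitrary: f G)
  case 0
  then show ?case by (auto intro: continuous_intros)
next
  case (Suc k)
  show ?case
  proof (rule Ck_on_SucI[OF assms(1)])
    show "((\<lambda>x. f x *\<^sub>R G x) has_derivative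
       (\<lambda>v. f x *\<^sub>R frechet_derivative G (at x) v + frechet_derivative f (at x) v *\<^sub>R G x)) (at x)"
      if "x \<in> U" for x
      using has_derivative_scaleR[OF Ck_on_Suc_derivative[OF assms(1) Suc.prems(1) that]
         Ck_on_Suc_derivative[OF assms(1) Suc.prems(2) that]] .
    show "Ck_on k (\<lambda>x. f x *\<^sub>R frechet_derivative G (at x) i + frechet_derivative f (at x) i *\<^sub>R G x) U"
      if "i \<in> Basis" for i
      using Suc.prems that Ck_on_Suc_imp[OF Suc.prems(1)] Ck_on_Suc_imp[OF Suc.prems(2)]
      by (intro Ck_on_add[OF assms(1)] Suc.IH) auto
  qed
qed

text \<open>The chain rule applies the derivative of \<open>G\<close> to a moving vector, while
  \<open>Ck_on\<close> controls derivatives in fixed directions only. Expanding that vector in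
  \<open>Basis\<close> leaves products of a component of the derivative of \<open>F\<close> and a
  composite of order one lower, which the induction with \<open>G\<close> arbitrary covers.\<close>

lemma Ck_on_compose:
  fixes F :: "'a::euclidean_space \<Rightarrow> 'b::euclidean_space" and G :: "'b \<Rightarrow> 'c::real_normed_vector"
  assumes "open U" "open V" "Ck_on k F U" "Ck_on k G V" "\<And>x. x \<in> U \<Longrightarrow> F x \<in> V"
  shows "Ck_on k (\<lambda>x. G (F x)) U"
  using assms(3,4)
proof (induction k arbitrary: G)
  case 0
  then show ?case using assms(5) by (auto intro!: continuous_on_compose2[of V G U F])
next
  case (Suc k)
  let ?DF = "\<lambda>x. frechet_derivative F (at x)" and ?DG = "\<lambda>y. frechet_derivative G (at y)"
  show ?case
  proof (rule Ck_on_SucI[OF assms(1)])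
    show "((\<lambda>x. G (F x)) has_derivative
       (\<lambda>v. \<Sum>j\<in>Basis. (?DF x v \<bullet> j) *\<^sub>R ?DG (F x) j)) (at x)"
      if x: "x \<in> U" for x
    proof -
      have G: "(G has_derivative ?DG (F x)) (at (F x))"
        using Ck_on_Suc_derivative[OF assms(2) Suc.prems(2)] assms(5) x by blast
      have lin: "linear (?DG (F x))"
        using G has_derivative_linear by blast
      have eq: "?DG (F x) w = (\<Sum>j\<in>Basis. (w \<bullet> j) *\<^sub>R ?DG (F x) j)" for w
      proof -
        have "?DG (F x) w = ?DG (F x) (\<Sum>j\<in>Basis. (w \<bullet> j) *\<^sub>R j)"
          by (simp add: euclidean_representation)
        then show ?thesis
          by (simp add: linear_sum[OF lin] linear_cmul[OF lin])
      qed
      show ?thesis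
        by (rule has_derivative_eq_rhs[OF
            has_derivative_compose[OF Ck_on_Suc_derivative[OF assms(1) Suc.prems(1) x] G]])
          (rule ext, rule eq)
    qed
    show "Ck_on k (\<lambda>x. \<Sum>j\<in>Basis. (?DF x i \<bullet> j) *\<^sub>R ?DG (F x) j) U" if "i \<in> Basis" for i
    proof (intro Ck_on_sum[OF assms(1)] Ck_on_scaleR[OF assms(1)])
      fix j :: 'b assume j: "j \<in> Basis"
      show "Ck_on k (\<lambda>x. ?DF x i \<bullet> j) U"
        by (rule Ck_on_bounded_linear[OF assms(1) bounded_linear_inner_left])
          (use Suc.prems(1) that in simp)
      show "Ck_on k (\<lambda>x. ?DG (F x) j) U"
        by (rule Suc.IH[OF Ck_on_Suc_imp[OF Suc.prems(1)]]) (use Suc.prems(2) j in auto)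
    qed
  qed
qed

lemma Ck_on_mult:
  fixes f g :: "_ \<Rightarrow> real"
  assumes "open U" "Ck_on k f U" "Ck_on k g U"
  shows "Ck_on k (\<lambda>x. f x * g x) U"
  using Ck_on_scaleR[OF assms] by simp

lemma Ck_on_inner:
  fixes F G :: "_ \<Rightarrow> 'b::euclidean_space"
  assumes "open U" "Ck_on k F U" "Ck_on k G U"
  shows "Ck_on k (\<lambda>x. F x \<bullet> G x) U"
  by (subst euclidean_inner, intro Ck_on_sum Ck_on_mult assms Ck_on_bounded_linear[OF assms(1) bounded_linear_inner_left])

text \<open>The derivative is a polynomial in \<open>inverse\<close> itself, so the induction
  hypothesis closes the step. \<open>Ck_on_sqrt\<close> works alike, since the derivative there is a
  smooth function of \<open>sqrt\<close>.\<close>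

lemma Ck_on_inverse_real: "Ck_on k (inverse :: real \<Rightarrow> real) {0<..}"
proof (induction k)
  case 0
  then show ?case by (auto intro!: continuous_intros)
next
  case (Suc k)
  show ?case
  proof (rule Ck_on_SucI[where F' = "\<lambda>x v. v *\<^sub>R - (inverse x * inverse x)"])
    show "(inverse has_derivative (\<lambda>v. v *\<^sub>R - (inverse x * inverse x))) (at x)"
      if "x \<in> {0<..}" for x :: real
      using that by (auto intro!: derivative_eq_intros)
    have "Ck_on k (\<lambda>x::real. -1 * (inverse x * inverse x)) {0<..}"
      by (intro Ck_on_mult Ck_on_const Suc) auto
    then show "Ck_on k (\<lambda>x::real. i *\<^sub>R - (inverse x * inverse x)) {0<..}" if "i \<in> Basis" for i :: real
      using that by simp
  qed auto
qed

lemma Ck_on_ln: "Ck_on k (ln :: real \<Rightarrow> real) {0<..}"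
proof (cases k)
  case 0
  then show ?thesis by (auto intro!: continuous_intros)
next
  case (Suc m)
  have "Ck_on (Suc m) (ln :: real \<Rightarrow> real) {0<..}"
  proof (rule Ck_on_SucI[where F' = "\<lambda>x v. v *\<^sub>R inverse x"])
    show "(ln has_derivative (\<lambda>v. v *\<^sub>R inverse x)) (at x)" if "x \<in> {0<..}" for x :: real
      using that by (auto intro!: derivative_eq_intros simp: divide_simps)
  qed (auto intro!: Ck_on_scaleR[where f = "\<lambda>_. _"] Ck_on_const Ck_on_inverse_real)
  then show ?thesis using Suc by simp
qed

lemma Ck_on_sqrt: "Ck_on k sqrt {0<..}"
proof (induction k)
  case 0
  then show ?case by (auto intro!: continuous_intros)
next
  case (Suc k)
  show ?case
  proof (rule Ck_on_SucI[where F' = "\<lambda>x v. v *\<^sub>R ((1/2) * inverse (sqrt x))"])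
    show "(sqrt has_derivative (\<lambda>v. v *\<^sub>R ((1/2) * inverse (sqrt x)))) (at x)"
      if "x \<in> {0<..}" for x :: real
      using that by (auto intro!: derivative_eq_intros simp: field_simps)
    have "Ck_on k (\<lambda>x. (1/2) * inverse (sqrt x)) {0<..}"
      by (intro Ck_on_mult Ck_on_const Ck_on_compose[OF _ _ Suc Ck_on_inverse_real]) auto
    then show "Ck_on k (\<lambda>x. i *\<^sub>R ((1/2) * inverse (sqrt x))) {0<..}" if "i \<in> Basis" for i :: real
      using that by simp
  qed auto
qed

lemma Ck_on_normalize: "Ck_on k (\<lambda>x::'a::euclidean_space. x /\<^sub>R norm x) (- {0})"
proof -
  have "Ck_on k (\<lambda>x::'a. sqrt (x \<bullet> x)) (- {0})"
    by (rule Ck_on_compose[OF _ _ _ Ck_on_sqrt]) (auto intro!: Ck_on_inner Ck_on_id)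
  then have "Ck_on k (\<lambda>x::'a. inverse (norm x)) (- {0})"
    unfolding norm_eq_sqrt_inner
    by (intro Ck_on_compose[OF _ _ _ Ck_on_inverse_real]) auto
  then show ?thesis
    by (intro Ck_on_scaleR Ck_on_id) auto
qed

section \<open>Calculus on the sphere\<close>

lemma normalize_in_S2: "x \<noteq> 0 \<Longrightarrow> x /\<^sub>R norm x \<in> S2" for x :: "real ^ 3"
  by (simp add: norm_divide)

lemma S2_nonzero: "x \<in> S2 \<Longrightarrow> x \<noteq> 0" for x :: "real ^ 3"
  by auto

lemma radial_on_S2: "x \<in> S2 \<Longrightarrow> radial f x = f x"
  by (simp add: radial_def[abs_def])

lemma smooth_S2_cong:
  assumes "\<And>x. x \<in> S2 \<Longrightarrow> f x = g x" "smooth_S2 f"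
  shows "smooth_S2 g"
  unfolding smooth_S2_def
proof
  fix k
  show "Ck_on k (radial g) (- {0})"
    by (rule Ck_on_cong[of _ "radial f"])
      (use assms normalize_in_S2 in \<open>auto simp: radial_def[abs_def] smooth_S2_def\<close>)
qed

lemma smooth_S2_compose_Ck_on:
  fixes F :: "real ^ 3 \<Rightarrow> 'b::euclidean_space" and G :: "'b \<Rightarrow> 'c::real_normed_vector"
  assumes "smooth_S2 F" "open V" "\<And>k. Ck_on k G V" "\<And>x. x \<in> S2 \<Longrightarrow> F x \<in> V"
  shows "smooth_S2 (\<lambda>x. G (F x))"
  unfolding smooth_S2_def radial_def[abs_def]
proof
  fix k
  show "Ck_on k (\<lambda>x. G (F (x /\<^sub>R norm x))) (- {0})"
    using assms normalize_in_S2
    by (intro Ck_on_compose[OF _ assms(2) _ assms(3)]) (auto simp: smooth_S2_def radial_def[abs_def])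
qed

lemma smooth_S2_id: "smooth_S2 (\<lambda>x. x)"
  using Ck_on_normalize by (auto simp: smooth_S2_def radial_def[abs_def])

lemma smooth_S2_const: "smooth_S2 (\<lambda>x. c)"
  by (simp add: smooth_S2_def radial_def[abs_def] Ck_on_const open_Compl)

lemma smooth_S2_add:
  assumes "smooth_S2 f" "smooth_S2 g" shows "smooth_S2 (\<lambda>x. f x + g x)"
  using assms by (auto simp: smooth_S2_def radial_def[abs_def] intro!: Ck_on_add)

lemma smooth_S2_scaleR:
  assumes "smooth_S2 f" "smooth_S2 g" shows "smooth_S2 (\<lambda>x. f x *\<^sub>R g x)"
  using assms by (auto simp: smooth_S2_def radial_def[abs_def] intro!: Ck_on_scaleR)

lemma smooth_S2_mult:
  fixes f g :: "real ^ 3 \<Rightarrow> real"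
  assumes "smooth_S2 f" "smooth_S2 g" shows "smooth_S2 (\<lambda>x. f x * g x)"
  using smooth_S2_scaleR[OF assms] by simp

lemma smooth_S2_inner:
  fixes f g :: "real ^ 3 \<Rightarrow> 'b::euclidean_space"
  assumes "smooth_S2 f" "smooth_S2 g" shows "smooth_S2 (\<lambda>x. f x \<bullet> g x)"
  using assms by (auto simp: smooth_S2_def radial_def[abs_def] intro!: Ck_on_inner)

text \<open>Off the sphere \<open>u\<close> is arbitrary, so the chain rule on open sets is applied
  to \<open>radial u\<close>, which agrees with \<open>u\<close> at all values of
  \<open>\<Phi>\<close>.\<close>

lemma smooth_S2_compose:
  assumes "smooth_S2 u" "smooth_S2 \<Phi>" "\<And>x. x \<in> S2 \<Longrightarrow> \<Phi> x \<in> S2"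
  shows "smooth_S2 (\<lambda>x. u (\<Phi> x))"
proof (rule smooth_S2_cong)
  show "smooth_S2 (\<lambda>x. radial u (\<Phi> x))"
  proof (rule smooth_S2_compose_Ck_on[OF assms(2)])
    show "Ck_on k (radial u) (- {0})" for k
      using assms(1) by (simp add: smooth_S2_def)
    show "\<Phi> x \<in> - {0}" if "x \<in> S2" for x
      using assms(3)[OF that] by auto
  qed auto
  show "radial u (\<Phi> x) = u (\<Phi> x)" if "x \<in> S2" for x
    using assms(3)[OF that] by (rule radial_on_S2)
qed

lemma smooth_S2_differentiable:
  assumes "smooth_S2 f" "x \<noteq> 0"
  shows "radial f differentiable at x"
proof -
  have "Ck_on (Suc 0) (radial f) (- {0})"
    using assms(1) unfolding smooth_S2_def by blast
  then show ?thesis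
    using assms(2) by (auto simp: differentiable_on_eq_differentiable_at open_Compl)
qed

lemma grad_S2_eqI:
  assumes "GDERIV (radial f) x :> D" shows "grad_S2 f x = D"
  unfolding grad_S2_def
proof (rule the_equality[of "\<lambda>D. GDERIV (radial f) x :> D", OF assms])
  fix D' assume "GDERIV (radial f) x :> D'"
  then have "(\<lambda>h. h \<bullet> D') = (\<lambda>h. h \<bullet> D)"
    using assms has_derivative_unique unfolding gderiv_def by blast
  then have "\<forall>h. h \<bullet> D' = h \<bullet> D"
    by (simp add: fun_eq_iff)
  then show "D' = D"
    using vector_eq_ldot by blast
qed

lemma smooth_S2_GDERIV:
  assumes "smooth_S2 f" "x \<noteq> 0"
  shows "GDERIV (radial f) x :> grad_S2 f x"
proof -
  let ?D = "frechet_derivative (radial f) (at x)"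
  have D: "(radial f has_derivative ?D) (at x)"
    using smooth_S2_differentiable[OF assms] frechet_derivative_works by blast
  then have lin: "linear ?D"
    using has_derivative_linear by blast
  have "?D h = h \<bullet> (\<Sum>i\<in>Basis. ?D i *\<^sub>R i)" for h
  proof -
    have "?D h = ?D (\<Sum>i\<in>Basis. (h \<bullet> i) *\<^sub>R i)"
      by (simp add: euclidean_representation)
    also have "\<dots> = h \<bullet> (\<Sum>i\<in>Basis. ?D i *\<^sub>R i)"
      by (simp add: linear_sum[OF lin] linear_cmul[OF lin] inner_sum_right mult.commute)
    finally show ?thesis .
  qed
  then have "?D = (\<lambda>h. h \<bullet> (\<Sum>i\<in>Basis. ?D i *\<^sub>R i))"
    by (rule ext)
  then have "GDERIV (radial f) x :> (\<Sum>i\<in>Basis. ?D i *\<^sub>R i)"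
    using D unfolding gderiv_def by (simp only:)
  then show ?thesis
    using grad_S2_eqI by metis
qed

text \<open>\<open>radial f\<close> is constant along the ray through \<open>x\<close>; the inner
  product is its derivative along that ray.\<close>

lemma grad_S2_orthogonal:
  assumes "smooth_S2 f" "x \<noteq> 0"
  shows "grad_S2 f x \<bullet> x = 0"
proof -
  have 1: "((\<lambda>t::real. radial f (t *\<^sub>R x)) has_derivative (\<lambda>t. (t *\<^sub>R x) \<bullet> grad_S2 f x)) (at 1)"
    by (rule has_derivative_compose[where g = "radial f"])
      (use smooth_S2_GDERIV[OF assms] in \<open>auto simp: gderiv_def intro!: derivative_eq_intros\<close>)
  have 2: "((\<lambda>t::real. radial f (t *\<^sub>R x)) has_derivative (\<lambda>t. 0)) (at 1)"
  proof (rule has_derivative_transform_within_open[of "\<lambda>t. radial f x"])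
    show "radial f x = radial f (t *\<^sub>R x)" if "t \<in> {0<..}" for t :: real
      using that by (simp add: radial_def field_simps)
  qed auto
  have "(\<lambda>t::real. (t *\<^sub>R x) \<bullet> grad_S2 f x) = (\<lambda>t. 0)"
    by (rule has_derivative_unique[OF 1 2])
  from fun_cong[OF this, of 1] show ?thesis by (simp add: inner_commute)
qed

lemma continuous_on_grad_S2:
  assumes "smooth_S2 f"
  shows "continuous_on (- {0}) (grad_S2 f)"
proof (subst continuous_on_componentwise, intro ballI)
  fix i :: "real ^ 3" assume i: "i \<in> Basis"
  have "Ck_on (Suc 0) (radial f) (- {0})"
    using assms unfolding smooth_S2_def by blast
  then have c: "continuous_on (- {0}) (\<lambda>x. frechet_derivative (radial f) (at x) i)"
    using i by simp
  have "frechet_derivative (radial f) (at x) i = grad_S2 f x \<bullet> i" if "x \<in> - {0}" for x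
    using frechet_derivative_at[OF smooth_S2_GDERIV[OF assms, of x, unfolded gderiv_def]] that
    by (metis ComplD inner_commute insertI1)
  then show "continuous_on (- {0}) (\<lambda>x. grad_S2 f x \<bullet> i)"
    using c continuous_on_cong by (metis (no_types, lifting))
qed

lemma smooth_S2_continuous_on:
  assumes "smooth_S2 f" shows "continuous_on S2 f"
proof -
  have "continuous_on (- {0}) (radial f)"
    using assms unfolding smooth_S2_def by (metis Ck_on.simps(1))
  then have "continuous_on S2 (radial f)"
    by (rule continuous_on_subset) auto
  then show ?thesis
    using radial_on_S2 continuous_on_cong by (metis (no_types, lifting))
qed

lemma grad_S2_const: "grad_S2 (\<lambda>x. c) x = 0"
  by (rule grad_S2_eqI) (simp add: radial_def[abs_def] GDERIV_const)

lemma grad_S2_mult: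
  assumes "smooth_S2 f" "smooth_S2 g" "x \<in> S2"
  shows "grad_S2 (\<lambda>x. f x * g x) x = f x *\<^sub>R grad_S2 g x + g x *\<^sub>R grad_S2 f x"
  using GDERIV_mult[OF smooth_S2_GDERIV[OF assms(1) S2_nonzero[OF assms(3)]]
      smooth_S2_GDERIV[OF assms(2) S2_nonzero[OF assms(3)]]] assms(3)
  by (intro grad_S2_eqI) (simp add: radial_def[abs_def])

lemma grad_S2_real_compose:
  assumes "smooth_S2 f" "x \<in> S2" "DERIV g (f x) :> d"
  shows "grad_S2 (\<lambda>x. g (f x)) x = d *\<^sub>R grad_S2 f x"
  using GDERIV_DERIV_compose[OF smooth_S2_GDERIV[OF assms(1) S2_nonzero[OF assms(2)]], of g d] assms(2,3)
  by (intro grad_S2_eqI) (simp add: radial_def[abs_def])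

lemma has_derivative_normalize:
  fixes x :: "'a::euclidean_space"
  assumes "x \<noteq> 0"
  shows "((\<lambda>x. x /\<^sub>R norm x) has_derivative
    (\<lambda>v. (v - (v \<bullet> (x /\<^sub>R norm x)) *\<^sub>R (x /\<^sub>R norm x)) /\<^sub>R norm x)) (at x)"
proof -
  have "((\<lambda>x::'a. inverse (norm x) *\<^sub>R x) has_derivative
     (\<lambda>v. inverse (norm x) *\<^sub>R v - (inverse (norm x) * (v \<bullet> sgn x) * inverse (norm x)) *\<^sub>R x)) (at x)"
    using assms by (auto intro!: derivative_eq_intros has_derivative_norm)
  then show ?thesis
    by (rule has_derivative_eq_rhs)
      (auto simp: sgn_div_norm scaleR_diff_right algebra_simps power2_eq_square)
qed

lemma grad_S2_coordinate:
  assumes "x \<in> S2"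
  shows "grad_S2 (\<lambda>x. x \<bullet> e) x = e - (x \<bullet> e) *\<^sub>R x"
proof (rule grad_S2_eqI)
  have "x \<noteq> 0" using assms by auto
  from has_derivative_inner_left[OF has_derivative_normalize[OF this], of e]
  show "GDERIV (radial (\<lambda>x. x \<bullet> e)) x :> e - (x \<bullet> e) *\<^sub>R x"
    unfolding gderiv_def radial_def[abs_def]
    by (rule has_derivative_eq_rhs) (use assms in \<open>auto simp: inner_diff_left inner_diff_right inner_commute\<close>)
qed

text \<open>With g the gradient of \<open>h\<close>, the product rule gives the gradient (x . e) g +
  h (e - (x . e) x). As g is orthogonal to x, the mixed terms add up to 2 h (g . x) = 0. The factor
  2 is 3 - 1, the sum of 1 - (x . e)^2 over the three axes.\<close>

lemma sum_norm_grad_S2_coordinate_mult: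
  assumes "smooth_S2 h" "x \<in> S2"
  shows "(\<Sum>e\<in>Basis. (norm (grad_S2 (\<lambda>x. (x \<bullet> e) * h x) x))\<^sup>2) = (norm (grad_S2 h x))\<^sup>2 + 2 * (h x)\<^sup>2"
proof -
  let ?g = "grad_S2 h x"
  have x: "x \<bullet> x = 1" using assms(2) by (simp add: norm_eq_sqrt_inner)
  have o: "?g \<bullet> x = 0" using grad_S2_orthogonal[OF assms(1) S2_nonzero[OF assms(2)]] .
  have *: "(norm (grad_S2 (\<lambda>x. (x \<bullet> e) * h x) x))\<^sup>2
      = (x \<bullet> e)\<^sup>2 * (?g \<bullet> ?g) + (h x)\<^sup>2 * (1 - (x \<bullet> e)\<^sup>2) + 2 * h x * ((x \<bullet> e) * (?g \<bullet> e))"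
    if "e \<in> Basis" for e
  proof -
    have "smooth_S2 (\<lambda>x. x \<bullet> e)"
      by (intro smooth_S2_inner smooth_S2_id smooth_S2_const)
    from grad_S2_mult[OF this assms]
    have eq: "grad_S2 (\<lambda>x. (x \<bullet> e) * h x) x = (x \<bullet> e) *\<^sub>R ?g + h x *\<^sub>R (e - (x \<bullet> e) *\<^sub>R x)"
      by (simp add: grad_S2_coordinate[OF assms(2)])
    have "e \<bullet> e = 1" using that by simp
    then show ?thesis
      unfolding eq power2_norm_eq_inner using x o
      by (simp add: inner_add_left inner_add_right inner_diff_left inner_diff_right inner_commute
          power2_eq_square algebra_simps)
  qed
  have b: "(\<Sum>e\<in>Basis. (x \<bullet> e)\<^sup>2) = 1"
    using x euclidean_inner[of x x] by (simp add: power2_eq_square)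
  have "(\<Sum>e\<in>Basis. (x \<bullet> e) * (?g \<bullet> e)) = 0"
    using o euclidean_inner[of x ?g] by (simp add: inner_commute)
  then show ?thesis
    using b by (simp add: * sum.distrib flip: sum_distrib_left sum_distrib_right)
      (simp add: sum_subtractf b power2_norm_eq_inner)
qed

section \<open>Spherical coordinates\<close>

text \<open>A real function is read as one with values in \<open>real ^ 1\<close>, to which
  \<open>has_absolute_integral_change_of_variables\<close> applies. The disjunction lets
  integrability be checked on the easier side: the domain for spherical coordinates, the image for
  maps of the ball.\<close>

lemma integral_change_of_variables_real:
  fixes f :: "real ^ 'm::{finite,wellorder} \<Rightarrow> real" and g :: "real ^ 'm::_ \<Rightarrow> real ^ 'm::_"
  assumes "S \<in> sets lebesgue"
    and "\<And>x. x \<in> S \<Longrightarrow> (g has_derivative g' x) (at x within S)"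
    and "inj_on g S"
    and "f absolutely_integrable_on (g ` S) \<or> (\<lambda>x. \<bar>det (matrix (g' x))\<bar> * f (g x)) absolutely_integrable_on S"
  shows "integral (g ` S) f = integral S (\<lambda>x. \<bar>det (matrix (g' x))\<bar> * f (g x))"
proof -
  have ai: "(\<lambda>x. vec (h x) :: real ^ 1) absolutely_integrable_on T \<longleftrightarrow> h absolutely_integrable_on T"
    for T and h :: "real ^ 'm::_ \<Rightarrow> real"
    using absolutely_integrable_componentwise_iff[where f = "\<lambda>x. vec (h x) :: real ^ 1" and A = T]
    by (simp add: Basis_vec_def inner_axis)
  have int: "integral T (\<lambda>x. vec (h x) :: real ^ 1) $ 1 = integral T h"
    if "h absolutely_integrable_on T" for h :: "real ^ 'm::_ \<Rightarrow> real" and T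
  proof -
    have "(\<lambda>x. vec (h x) :: real ^ 1) integrable_on T"
      using that ai[of T h] set_lebesgue_integral_eq_integral(1) by blast
    from integral_component_eq_cart[OF this, of 1] show ?thesis by simp
  qed
  let ?h = "\<lambda>x. \<bar>det (matrix (g' x))\<bar> * f (g x)"
  have eq: "(\<lambda>x. \<bar>det (matrix (g' x))\<bar> *\<^sub>R (vec (f (g x)) :: real ^ 1)) = (\<lambda>x. vec (?h x))"
    by (simp add: vec_eq_iff fun_eq_iff)
  note cov = has_absolute_integral_change_of_variables
    [OF assms(1-3), of "\<lambda>x. vec (f x) :: real ^ 1", unfolded eq]
  let ?I = "integral (g ` S) (\<lambda>x. vec (f x) :: real ^ 1)" and ?J = "integral S (\<lambda>x. vec (?h x) :: real ^ 1)"
  have both: "f absolutely_integrable_on (g ` S)" "?h absolutely_integrable_on S"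
    using assms(4) cov[of ?I] cov[of ?J] unfolding ai by auto
  then have "?I = ?J"
    using cov[of ?I] unfolding ai by simp
  then show ?thesis
    using int[OF both(1)] int[OF both(2)] by simp
qed

text \<open>Identifies nested pairs with \<open>real ^ 3\<close>: the change of variables lives on
  \<open>real ^ 3\<close>, Fubini on products.\<close>

definition vec3 :: "real \<times> real \<times> real \<Rightarrow> real ^ 3" where
  "vec3 = (\<lambda>(a, b, c). a *\<^sub>R axis 1 1 + b *\<^sub>R axis 2 1 + c *\<^sub>R axis 3 1)"

lemma vec3_nth [simp]: "vec3 (a, b, c) $ 1 = a" "vec3 (a, b, c) $ 2 = b" "vec3 (a, b, c) $ 3 = c"
  by (simp_all add: vec3_def axis_def)

lemma continuous_on_vec3: "continuous_on A vec3"
  unfolding vec3_def case_prod_unfold by (intro continuous_intros)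

lemma measurable_vec3: "vec3 \<in> borel_measurable borel"
  by (intro borel_measurable_continuous_onI continuous_on_vec3)

lemma emeasure_lborel_Times:
  fixes A :: "'a::euclidean_space set" and B :: "'b::euclidean_space set"
  assumes "A \<in> sets borel" "B \<in> sets borel"
  shows "emeasure lborel (A \<times> B) = emeasure lborel A * emeasure lborel B"
  using assms by (subst lborel_prod[symmetric]) (simp add: lborel.emeasure_pair_measure_Times)

text \<open>Lebesgue measure is determined by the volumes of boxes, and the preimage of a box is a
  product of three intervals.\<close>

lemma lborel_eq_distr_vec3: "lborel = distr lborel borel vec3"
proof (rule lborel_eqI)
  fix l u :: "real ^ 3"
  assume lu: "\<And>b. b \<in> Basis \<Longrightarrow> l \<bullet> b \<le> u \<bullet> b"
  then have le: "l $ i \<le> u $ i" for i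
    by (metis axis_in_Basis_iff cart_eq_inner_axis Basis_real_def insertI1)
  have pre: "vec3 -` box l u = {l $ 1 <..< u $ 1} \<times> {l $ 2 <..< u $ 2} \<times> {l $ 3 <..< u $ 3}"
    by (auto simp: mem_box_cart forall_3)
  have "emeasure (distr lborel borel vec3) (box l u) = emeasure lborel (vec3 -` box l u)"
    using measurable_vec3 by (subst emeasure_distr) auto
  also have "\<dots> = emeasure lborel {l $ 1 <..< u $ 1} *
      (emeasure lborel {l $ 2 <..< u $ 2} * emeasure lborel {l $ 3 <..< u $ 3})"
    unfolding pre by (subst emeasure_lborel_Times; (subst emeasure_lborel_Times)?)
      (auto intro!: borel_open open_Times)
  also have "\<dots> = ennreal (u $ 1 - l $ 1) * (ennreal (u $ 2 - l $ 2) * ennreal (u $ 3 - l $ 3))"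
    by (simp only: emeasure_lborel_Ioo[OF le])
  also have "\<dots> = ennreal (\<Prod>i\<in>UNIV. u $ i - l $ i)"
  proof -
    have "(\<Prod>i\<in>UNIV. u $ i - l $ i) = (u $ 1 - l $ 1) * ((u $ 2 - l $ 2) * (u $ 3 - l $ 3))"
      unfolding UNIV_3 by simp
    moreover have "0 \<le> u $ i - l $ i" for i
      using le by simp
    ultimately show ?thesis
      by (simp only: ennreal_mult mult_nonneg_nonneg)
  qed
  also have "(\<Prod>i\<in>UNIV. u $ i - l $ i) = (\<Prod>b\<in>Basis. (u - l) \<bullet> b)"
  proof -
    have B: "(Basis :: (real ^ 3) set) = (\<lambda>i. axis i 1) ` UNIV"
      by (auto simp: Basis_vec_def)
    show ?thesis
      unfolding B by (subst prod.reindex) (auto simp: inj_on_def axis_eq_axis inner_axis)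
  qed
  finally show "emeasure (distr lborel borel vec3) (box l u) = (\<Prod>b\<in>Basis. (u - l) \<bullet> b)" .
qed simp

lemma polar_eq_vec3: "polar (a, b) = vec3 (sin a * cos b, sin a * sin b, cos a)"
  by (simp add: polar_def vec_eq_iff forall_3)

lemma polar_in_S2: "polar z \<in> S2"
proof (cases z)
  case (Pair a b)
  have "(sin a * cos b)\<^sup>2 + (sin a * sin b)\<^sup>2 + (cos a)\<^sup>2 = (sin a)\<^sup>2 * ((cos b)\<^sup>2 + (sin b)\<^sup>2) + (cos a)\<^sup>2"
    by (simp only: power_mult_distrib distrib_left)
  then have "(sin a * cos b)\<^sup>2 + (sin a * sin b)\<^sup>2 + (cos a)\<^sup>2 = 1"
    by simp
  then show ?thesis
    using Pair by (simp add: polar_eq_vec3 norm_eq_sqrt_inner inner_vec_def sum_3 power2_eq_square)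
qed

lemma norm_polar [simp]: "norm (polar z) = 1"
  using polar_in_S2[of z] by simp

lemma continuous_on_polar: "continuous_on A polar"
proof -
  have eq: "polar = (\<lambda>z. vec3 (sin (fst z) * cos (snd z), sin (fst z) * sin (snd z), cos (fst z)))"
    by (auto simp: fun_eq_iff polar_eq_vec3)
  show ?thesis
    unfolding eq
    by (intro continuous_on_compose2[OF continuous_on_vec3[of UNIV]] continuous_intros) auto
qed

lemma measurable_polar: "polar \<in> measurable borel borel_S2"
  by (intro measurable_restrict_space2 borel_measurable_continuous_onI continuous_on_polar)
    (use polar_in_S2 in blast)

section \<open>Spherical coordinates (radius, polar angle, azimuth) on the unit ball\<close>

definition spherical :: "real ^ 3 \<Rightarrow> real ^ 3" where
  "spherical v = (v $ 1) *\<^sub>R polar (v $ 2, v $ 3)"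

definition spherical' :: "real ^ 3 \<Rightarrow> real ^ 3 \<Rightarrow> real ^ 3" where
  "spherical' v w =
    vec3 (w $ 1 * (sin (v $ 2) * cos (v $ 3)) + w $ 2 * (v $ 1 * cos (v $ 2) * cos (v $ 3))
            - w $ 3 * (v $ 1 * sin (v $ 2) * sin (v $ 3)),
          w $ 1 * (sin (v $ 2) * sin (v $ 3)) + w $ 2 * (v $ 1 * cos (v $ 2) * sin (v $ 3))
            + w $ 3 * (v $ 1 * sin (v $ 2) * cos (v $ 3)),
          w $ 1 * cos (v $ 2) - w $ 2 * (v $ 1 * sin (v $ 2)))"

lemma has_derivative_vec3:
  assumes "(f has_derivative f') F" "(g has_derivative g') F" "(h has_derivative h') F"
  shows "((\<lambda>x. vec3 (f x, g x, h x)) has_derivative (\<lambda>x. vec3 (f' x, g' x, h' x))) F"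
  unfolding vec3_def by (auto intro!: derivative_eq_intros assms)

lemma has_derivative_spherical: "(spherical has_derivative spherical' v) (at v within A)"
proof -
  have eq: "spherical = (\<lambda>v. vec3 (v $ 1 * (sin (v $ 2) * cos (v $ 3)), v $ 1 * (sin (v $ 2) * sin (v $ 3)), v $ 1 * cos (v $ 2)))"
    by (simp add: fun_eq_iff spherical_def polar_eq_vec3 vec_eq_iff forall_3)
  note nth = bounded_linear.has_derivative[OF bounded_linear_vec_nth has_derivative_ident]
  show ?thesis
    unfolding eq spherical'_def[abs_def]
    by (rule has_derivative_vec3; rule has_derivative_eq_rhs, (rule derivative_intros nth)+)
      (auto simp: fun_eq_iff algebra_simps)
qed

lemma det_spherical: "det (matrix (spherical' v)) = (v $ 1)\<^sup>2 * sin (v $ 2)"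
proof -
  let ?s = "sin (v $ 2)" and ?c = "cos (v $ 2)" and ?S = "sin (v $ 3)" and ?C = "cos (v $ 3)"
  \<comment> \<open>In this form the claim is a polynomial identity in the sines and cosines; the
    Pythagorean rules are switched off until it has been verified.\<close>
  have "det (matrix (spherical' v)) = (v $ 1)\<^sup>2 * ?s * ((?s\<^sup>2 + ?c\<^sup>2) * (?S\<^sup>2 + ?C\<^sup>2))"
    unfolding det_3 matrix_def spherical'_def
    by (simp add: axis_def power2_eq_square algebra_simps del: sin_cos_squared_add sin_cos_squared_add2 sin_cos_squared_add3)
  then show ?thesis by simp
qed

abbreviation spherical_domain :: "(real ^ 3) set" where
  "spherical_domain \<equiv> box 0 (vec3 (1, pi, 2 * pi))"

text \<open>The coordinates are recovered in turn: the radius from the norm, the polar angle from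
  its cosine, and then, since its sine is positive, the cosine and sine of the azimuth. These fix
  the azimuth up to a multiple of 2 \<pi>, which the open interval rules out.\<close>

lemma inj_on_spherical: "inj_on spherical spherical_domain"
proof (rule inj_onI)
  fix v w assume v: "v \<in> spherical_domain" and w: "w \<in> spherical_domain" and eq: "spherical v = spherical w"
  have n: "norm (spherical z) = z $ 1" if "z \<in> spherical_domain" for z
    using that polar_in_S2[of "(z $ 2, z $ 3)"] by (simp add: spherical_def mem_box_cart forall_3)
  have 1: "v $ 1 = w $ 1" using n[OF v] n[OF w] eq by simp
  then have p: "polar (v $ 2, v $ 3) = polar (w $ 2, w $ 3)"
    using eq v by (simp add: spherical_def mem_box_cart forall_3)
  then have "cos (v $ 2) = cos (w $ 2)"
    by (simp add: polar_eq_vec3 vec_eq_iff forall_3)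
  then have 2: "v $ 2 = w $ 2"
    using v w by (intro cos_inj_pi[OF _ _ _ _ \<open>cos (v $ 2) = cos (w $ 2)\<close>]) (auto simp: mem_box_cart forall_3)
  have "sin (v $ 2) > 0" using v by (auto simp: mem_box_cart forall_3 sin_gt_zero)
  then have sc: "cos (v $ 3) = cos (w $ 3)" "sin (v $ 3) = sin (w $ 3)"
    using p 2 by (simp_all add: polar_eq_vec3 vec_eq_iff forall_3)
  have 3: "v $ 3 = w $ 3"
  proof -
    obtain n where n: "v $ 3 = w $ 3 + 2 * pi * of_int n"
      using sin_cos_eq_iff[of "v $ 3" "w $ 3"] sc by auto
    have "v $ 3 \<in> {0<..<2*pi}" "w $ 3 \<in> {0<..<2*pi}"
      using v w by (auto simp: mem_box_cart forall_3)
    then have l: "2 * pi * real_of_int n < 2 * pi * 1" and u: "2 * pi * (-1) < 2 * pi * real_of_int n"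
      unfolding greaterThanLessThan_iff using n by linarith+
    have "real_of_int n < 1"
      by (rule mult_less_cancel_left_pos[THEN iffD1, OF _ l]) simp
    moreover have "-1 < real_of_int n"
      by (rule mult_less_cancel_left_pos[THEN iffD1, OF _ u]) simp
    ultimately have "n = 0" by linarith
    then show ?thesis using n by simp
  qed
  show "v = w" using 1 2 3 by (simp add: vec_eq_iff forall_3)
qed

lemma spherical_image_subset: "spherical ` spherical_domain \<subseteq> ball 0 1 - {0}"
proof
  fix x assume "x \<in> spherical ` spherical_domain"
  then obtain z where z: "z \<in> spherical_domain" "x = spherical z" by blast
  have "norm (spherical z) = z $ 1"
    using z polar_in_S2[of "(z $ 2, z $ 3)"] by (simp add: spherical_def mem_box_cart forall_3)
  then show "x \<in> ball 0 1 - {0}"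
    using z by (auto simp: mem_box_cart forall_3)
qed

text \<open>What the open box misses is the half disc of azimuth zero, axis included. Enclosing it
  in a whole plane makes it a null set at once.\<close>

lemma ball_diff_spherical_image: "ball 0 1 - spherical ` spherical_domain \<subseteq> {x. axis 2 1 \<bullet> x = 0}"
proof (rule subsetI, rule ccontr)
  fix x :: "real ^ 3"
  assume x: "x \<in> ball 0 1 - spherical ` spherical_domain" and "x \<notin> {x. axis 2 1 \<bullet> x = 0}"
  then have x2: "x $ 2 \<noteq> 0" by (simp add: inner_axis')
  define r where "r = norm x"
  have r: "0 < r" "r < 1" using x x2 by (auto simp: r_def)
  have r2: "r\<^sup>2 = (x $ 1)\<^sup>2 + (x $ 2)\<^sup>2 + (x $ 3)\<^sup>2"
    unfolding r_def power2_norm_eq_inner by (simp add: inner_vec_def sum_3 power2_eq_square)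
  have "(x $ 2)\<^sup>2 > 0" using x2 by simp
  then have "(x $ 3)\<^sup>2 < r\<^sup>2" using r2 by (smt (verit) zero_le_power2)
  then have x3: "\<bar>x $ 3\<bar> < r" using r by (metis abs_of_pos power2_less_imp_less abs_ge_zero power2_abs)
  define a where "a = arccos (x $ 3 / r)"
  have ca: "cos a = x $ 3 / r" using x3 r unfolding a_def by (intro cos_arccos) (auto simp: field_simps)
  have a: "0 < a" "a < pi"
    using x3 r arccos_lt_bounded[of "x $ 3 / r"] unfolding a_def by (auto simp: field_simps)
  have sa: "sin a > 0" using a by (rule sin_gt_zero)
  have sa2: "(r * sin a)\<^sup>2 = (x $ 1)\<^sup>2 + (x $ 2)\<^sup>2"
  proof -
    have "(r * sin a)\<^sup>2 = r\<^sup>2 - (r * cos a)\<^sup>2"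
      by (simp add: power_mult_distrib sin_squared_eq right_diff_distrib)
    then show ?thesis using ca r r2 by simp
  qed
  have "(x $ 1 / (r * sin a))\<^sup>2 + (x $ 2 / (r * sin a))\<^sup>2 = 1"
    unfolding power_divide add_divide_distrib[symmetric] sa2[symmetric] using sa r by simp
  then obtain b where b: "0 \<le> b" "b < 2 * pi" "x $ 1 / (r * sin a) = cos b" "x $ 2 / (r * sin a) = sin b"
    by (rule sincos_total_2pi)
  have "b \<noteq> 0" using b(4) x2 sa r by auto
  then have "vec3 (r, a, b) \<in> spherical_domain"
    using a b r by (auto simp: mem_box_cart forall_3)
  moreover have "spherical (vec3 (r, a, b)) = x"
    using b(3,4) ca sa r by (auto simp: spherical_def polar_eq_vec3 vec_eq_iff forall_3 field_simps)
  ultimately show False using x by force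
qed

section \<open>The area measure in polar coordinates and as an integral over the ball\<close>

lemma sets_area_S2: "sets area_S2 = sets borel_S2"
  by (simp add: area_S2_def)

lemma space_area_S2: "space area_S2 = S2"
  by (simp add: area_S2_def space_restrict_space)

lemma continuous_on_S2_measurable: "continuous_on S2 k \<Longrightarrow> k \<in> borel_measurable borel_S2"
  for k :: "real ^ 3 \<Rightarrow> 'b::{second_countable_topology,metric_space}"
  by (rule borel_measurable_continuous_on_restrict)

abbreviation polar_domain :: "(real \<times> real) set" where
  "polar_domain \<equiv> {0..pi} \<times> {0..2 * pi}"

lemma sets_polar_domain: "polar_domain \<inter> space lborel \<in> sets lborel"
  by (simp add: borel_closed closed_Times)

lemma area_S2_integral_polar:
  fixes k :: "real ^ 3 \<Rightarrow> real"
  assumes "continuous_on S2 k"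
  shows "(\<integral>x. k x \<partial>area_S2)
    = (\<integral>z. indicator polar_domain z * (sin (fst z) * k (polar z)) \<partial>lborel)"
proof -
  let ?R = "restrict_space lborel polar_domain"
  have m: "polar \<in> measurable (density ?R (\<lambda>(\<theta>, \<phi>). ennreal (sin \<theta>))) borel_S2"
    using measurable_polar by (simp add: measurable_restrict_space1)
  have k: "k \<in> borel_measurable borel_S2" by (rule continuous_on_S2_measurable[OF assms])
  have kp: "(\<lambda>z. k (polar z)) \<in> borel_measurable ?R"
    using measurable_compose[OF measurable_polar k] by (simp add: measurable_restrict_space1)
  have s: "(\<lambda>z. sin (fst z)) \<in> borel_measurable ?R"
    by (intro measurable_restrict_space1) (simp add: borel_measurable_continuous_onI continuous_intros)
  have nn: "AE z in ?R. 0 \<le> sin (fst z)"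
    by (rule AE_I2) (auto simp: space_restrict_space intro: sin_ge_zero)
  have "(\<integral>x. k x \<partial>area_S2) = (\<integral>z. k (polar z) \<partial>density ?R (\<lambda>z. ennreal (sin (fst z))))"
    using m k unfolding area_S2_def by (subst integral_distr) (auto simp: case_prod_unfold)
  also have "\<dots> = (\<integral>z. sin (fst z) * k (polar z) \<partial>?R)"
    using kp s nn by (subst integral_density) auto
  also have "\<dots> = (\<integral>z. indicator polar_domain z * (sin (fst z) * k (polar z)) \<partial>lborel)"
    using sets_polar_domain by (subst integral_restrict_space) auto
  finally show ?thesis .
qed

lemma finite_measure_area_S2: "finite_measure area_S2"
proof
  let ?R = "restrict_space lborel polar_domain"
  have "emeasure area_S2 (space area_S2) = emeasure (density ?R (\<lambda>(\<theta>, \<phi>). ennreal (sin \<theta>))) (space ?R)"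
  proof -
    have m: "polar \<in> measurable (density ?R (\<lambda>(\<theta>, \<phi>). ennreal (sin \<theta>))) borel_S2"
      using measurable_polar by (simp add: measurable_restrict_space1)
    have "polar -` space borel_S2 \<inter> space ?R = space ?R"
      by (auto simp: space_restrict_space)
    then show ?thesis
      using emeasure_distr[OF m sets.top] by (simp add: area_S2_def)
  qed
  also have "\<dots> \<le> (\<integral>\<^sup>+z. 1 \<partial>?R)"
  proof (subst emeasure_density)
    have "(\<lambda>z :: real \<times> real. sin (fst z)) \<in> borel_measurable borel"
      by (intro borel_measurable_continuous_onI continuous_intros)
    then show "(\<lambda>(\<theta>, \<phi>). ennreal (sin \<theta>)) \<in> borel_measurable ?R"
      by (simp add: case_prod_unfold measurable_restrict_space1)
  qed (auto intro!: nn_integral_mono simp: indicator_def simp del: nn_integral_const)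
  also have "\<dots> = emeasure lborel polar_domain"
    using sets_polar_domain by (simp add: emeasure_restrict_space space_restrict_space)
  also have "\<dots> < \<infinity>"
    by (simp add: emeasure_lborel_Times ennreal_mult_less_top)
  finally show "emeasure area_S2 (space area_S2) \<noteq> \<infinity>" by simp
qed

text \<open>The factor 3 is the inverse of \<integral>r^2 dr over [0, 1], r^2 being the radial part
  of the Jacobian. Through this identity the total area and the behaviour under rotations and
  Moebius maps are reduced to facts about \<open>real ^ 3\<close>.\<close>

lemma area_S2_integral_ball:
  fixes k :: "real ^ 3 \<Rightarrow> real"
  assumes k: "continuous_on S2 k"
  shows "(\<integral>x. k x \<partial>area_S2) = 3 * integral (ball 0 1) (radial k)"
proof -
  let ?D = "spherical_domain" and ?C = "cbox 0 (vec3 (1, pi, 2 * pi))"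
  define G where "G v = (v $ 1)\<^sup>2 * (sin (v $ 2) * k (polar (v $ 2, v $ 3)))" for v :: "real ^ 3"
  have kp: "continuous_on UNIV (\<lambda>z. k (polar z))"
    by (rule continuous_on_compose2[OF k continuous_on_polar]) (use polar_in_S2 in auto)
  have G: "continuous_on A G" for A
    unfolding G_def
    by (intro continuous_intros continuous_on_compose2[OF kp]) auto
  have mG: "(\<lambda>v. indicator ?C v * G v) \<in> borel_measurable borel"
    by (intro borel_measurable_times borel_measurable_indicator borel_measurable_continuous_onI[OF G])
      simp
  have Gint: "G absolutely_integrable_on ?C"
    by (rule absolutely_integrable_continuous[OF G])
  have GD: "G absolutely_integrable_on ?D"
    using Gint by (rule set_integrable_subset) (auto simp: box_subset_cbox)
  have det: "\<bar>det (matrix (spherical' v))\<bar> * radial k (spherical v) = G v" if "v \<in> ?D" for v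
  proof -
    have v: "0 < v $ 1" "0 < v $ 2" "v $ 2 < pi" using that by (auto simp: mem_box_cart forall_3)
    then have "radial k (spherical v) = k (polar (v $ 2, v $ 3))"
      using polar_in_S2[of "(v $ 2, v $ 3)"] by (simp add: radial_def spherical_def)
    then show ?thesis using v sin_gt_zero[of "v $ 2"] by (simp add: det_spherical G_def abs_mult)
  qed
  have ai: "(\<lambda>v. \<bar>det (matrix (spherical' v))\<bar> * radial k (spherical v)) absolutely_integrable_on ?D"
    by (rule iffD2[OF set_integrable_cong GD], rule refl, rule refl, erule det)
  have "integral (ball 0 1) (radial k) = integral (spherical ` ?D) (radial k)"
  proof (rule integral_spike_set)
    have "negligible {x :: real ^ 3. axis 2 1 \<bullet> x = 0}"
      by (rule negligible_hyperplane) (simp add: axis_eq_0_iff)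
    then show "negligible {x \<in> ball 0 1 - spherical ` ?D. radial k x \<noteq> 0}"
      by (rule negligible_subset) (use ball_diff_spherical_image in auto)
    have "{x \<in> spherical ` ?D - ball 0 1. radial k x \<noteq> 0} = {}"
      using spherical_image_subset by auto
    then show "negligible {x \<in> spherical ` ?D - ball 0 1. radial k x \<noteq> 0}"
      using negligible_empty by metis
  qed
  also have "\<dots> = integral ?D (\<lambda>v. \<bar>det (matrix (spherical' v))\<bar> * radial k (spherical v))"
    using ai by (intro integral_change_of_variables_real has_derivative_spherical inj_on_spherical) auto
  also have "\<dots> = integral ?D G"
    by (intro integral_cong det)
  also have "\<dots> = integral ?C G"
    by (rule integral_open_interval)
  also have "\<dots> = (LINT v:?C|lebesgue. G v)"
    using set_lebesgue_integral_eq_integral(2)[OF Gint] by simp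
  also have "\<dots> = (\<integral>v. indicator ?C v * G v \<partial>lborel)"
    unfolding set_lebesgue_integral_def
    by (subst integral_completion) (use mG in auto)
  finally have 1: "integral (ball 0 1) (radial k) = (\<integral>v. indicator ?C v * G v \<partial>lborel)" .
  have intG: "integrable lborel (\<lambda>v. indicator ?C v * G v)"
    using Gint unfolding set_integrable_def
    by (subst (asm) integrable_completion) (use mG in auto)
  \<comment> \<open>On triples the integrand splits into a function of the radius and a function of
    the two angles, ready for Fubini.\<close>
  let ?F = "\<lambda>p :: real \<times> real \<times> real. (fst p)\<^sup>2 * indicator {0..1} (fst p) *
      (indicator polar_domain (snd p) * (sin (fst (snd p)) * k (polar (snd p))))"
  have F: "indicator ?C (vec3 p) * G (vec3 p) = ?F p" for p
    by (cases p) (auto simp: G_def indicator_def mem_box_cart forall_3)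
  have 2: "(\<integral>v. indicator ?C v * G v \<partial>lborel) = (\<integral>p. ?F p \<partial>lborel)"
    using measurable_vec3 mG by (subst lborel_eq_distr_vec3, subst integral_distr) (auto simp: F)
  have "integrable lborel ?F"
  proof -
    have "integrable (distr lborel borel vec3) (\<lambda>v. indicator ?C v * G v)"
      using intG by (simp flip: lborel_eq_distr_vec3)
    then show ?thesis
      using measurable_vec3 mG by (subst (asm) integrable_distr_eq) (auto simp: F)
  qed
  then have "integrable (lborel \<Otimes>\<^sub>M lborel) ?F"
    by (simp add: lborel_prod)
  from lborel_pair.integral_fst'[OF this]
  have "(\<integral>p. ?F p \<partial>lborel) = (\<integral>a. a\<^sup>2 * indicator {0..1} a *
      (\<integral>z. indicator polar_domain z * (sin (fst z) * k (polar z)) \<partial>lborel) \<partial>lborel)"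
    by (simp add: lborel_prod)
  also have "\<dots> = (\<integral>x. k x \<partial>area_S2) / 3"
    using integral_power[of 0 1 2] by (simp add: area_S2_integral_polar[OF k])
  finally show ?thesis using 1 2 by simp
qed

lemma measure_area_S2: "measure area_S2 S2 = 4 * pi"
proof -
  have "measure area_S2 S2 = (\<integral>x. 1 \<partial>area_S2)"
    by (simp add: space_area_S2)
  also have "\<dots> = 3 * integral (ball 0 1) (\<lambda>x :: real ^ 3. 1)"
    using area_S2_integral_ball[of "\<lambda>x. 1"] by (simp add: radial_def[abs_def])
  also have "integral (ball 0 1) (\<lambda>x :: real ^ 3. 1 :: real) = measure lborel (ball 0 1 :: (real ^ 3) set)"
    by (simp add: lmeasure_integral[symmetric] measure_completion)
  also have "\<dots> = 4 / 3 * pi"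
    by (simp add: content_ball unit_ball_vol_3)
  finally show ?thesis by simp
qed

section \<open>Moebius transformations of the sphere\<close>

text \<open>
  Change of variables on the sphere, obtained from the one in \<open>real ^ 3\<close> for the extension of \<open>\<Phi>\<close>
  that is positively homogeneous of degree one and hence preserves the unit ball.
\<close>

lemma area_S2_integral_lift:
  fixes k J :: "real ^ 3 \<Rightarrow> real"
  assumes bij: "bij_betw \<Phi> S2 S2" and \<Phi>: "continuous_on S2 \<Phi>"
    and J: "continuous_on S2 J" and k: "continuous_on S2 k"
    and der: "\<And>x. x \<noteq> 0 \<Longrightarrow> ((\<lambda>x. norm x *\<^sub>R radial \<Phi> x) has_derivative \<Psi>' x) (at x)"
    and det: "\<And>x. x \<noteq> 0 \<Longrightarrow> \<bar>det (matrix (\<Psi>' x))\<bar> = J (x /\<^sub>R norm x)"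
  shows "(\<integral>x. J x * k (\<Phi> x) \<partial>area_S2) = (\<integral>x. k x \<partial>area_S2)"
proof -
  let ?S = "ball 0 1 - {0} :: (real ^ 3) set" and ?\<Psi> = "\<lambda>x. norm x *\<^sub>R radial \<Phi> x"
  have im: "\<Phi> ` S2 \<subseteq> S2" using bij by (simp add: bij_betw_def)
  have rad: "radial \<Phi> x \<in> S2" if "x \<noteq> 0" for x
    unfolding radial_def using im normalize_in_S2[OF that] by blast
  have norm: "norm (?\<Psi> x) = norm x" if "x \<noteq> 0" for x
    using rad[OF that] by simp
  have inj: "inj_on ?\<Psi> ?S"
  proof (rule inj_onI)
    fix x y assume x: "x \<in> ?S" and y: "y \<in> ?S" and eq: "?\<Psi> x = ?\<Psi> y"
    have n: "norm x = norm y" using norm[of x] norm[of y] x y eq by simp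
    then have "radial \<Phi> x = radial \<Phi> y" using eq x y by auto
    then have "x /\<^sub>R norm x = y /\<^sub>R norm y"
      using bij normalize_in_S2[of x] normalize_in_S2[of y] x y
      unfolding radial_def bij_betw_def inj_on_def by blast
    then show "x = y" using n x by auto
  qed
  have onto: "?\<Psi> ` ?S = ?S"
  proof
    show "?\<Psi> ` ?S \<subseteq> ?S"
    proof
      fix y assume "y \<in> ?\<Psi> ` ?S"
      then obtain x where "x \<in> ?S" "y = ?\<Psi> x" by blast
      then have "norm y = norm x" "norm x < 1" "norm x > 0" using norm[of x] by auto
      then show "y \<in> ?S" by auto
    qed
    show "?S \<subseteq> ?\<Psi> ` ?S"
    proof
      fix y assume y: "y \<in> ?S"
      then have "y /\<^sub>R norm y \<in> \<Phi> ` S2"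
        using bij_betw_imp_surj_on[OF bij] normalize_in_S2[of y] by simp
      then obtain u where u: "u \<in> S2" "y /\<^sub>R norm y = \<Phi> u"
        by (elim imageE)
      have "norm (norm y *\<^sub>R u) = norm y" "(norm y *\<^sub>R u) /\<^sub>R norm (norm y *\<^sub>R u) = u"
        using u y by auto
      then have eq: "?\<Psi> (norm y *\<^sub>R u) = y" using u(2)[symmetric] y by (simp add: radial_def)
      show "y \<in> ?\<Psi> ` ?S"
        by (rule image_eqI[where f = ?\<Psi>, OF eq[symmetric]]) (use u y in auto)
    qed
  qed
  have "bounded (k ` S2)"
    using compact_imp_bounded[OF compact_continuous_image[OF k]] by simp
  then obtain B where "\<forall>y\<in>k ` S2. norm y \<le> B"
    unfolding bounded_iff by blast
  then have B: "\<bar>k x\<bar> \<le> B" if "x \<in> S2" for x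
    using that by auto
  have radk: "continuous_on ?S (radial k)"
    unfolding radial_def
  proof (rule continuous_on_compose2[OF k])
    show "continuous_on ?S (\<lambda>x. x /\<^sub>R norm x)"
      by (auto intro!: continuous_intros)
    show "(\<lambda>x. x /\<^sub>R norm x) ` ?S \<subseteq> S2"
      by (intro image_subsetI normalize_in_S2) simp
  qed
  have S: "?S \<in> sets lebesgue" by auto
  have ai: "radial k absolutely_integrable_on ?S"
  proof (rule measurable_bounded_by_integrable_imp_absolutely_integrable[OF _ S])
    show "radial k \<in> borel_measurable (lebesgue_on ?S)"
      by (rule continuous_imp_measurable_on_sets_lebesgue[OF radk S])
    have "?S \<in> lmeasurable" by (intro fmeasurable_Diff) auto
    then show "(\<lambda>x. B) integrable_on ?S"
      by (rule integrable_on_const)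
    show "norm (radial k x) \<le> B" if "x \<in> ?S" for x
      using B normalize_in_S2[of x] that by (simp add: radial_def)
  qed
  \<comment> \<open>The origin is left out because the homogeneous extension need not be
    differentiable there; a single point is a null set.\<close>
  have ball: "integral (ball 0 1) h = integral ?S h" for h :: "real ^ 3 \<Rightarrow> real"
  proof (rule integral_spike_set)
    show "negligible {x \<in> ball 0 1 - ?S. h x \<noteq> 0}"
      by (rule negligible_subset[of "{0}"]) auto
    show "negligible {x \<in> ?S - ball 0 1. h x \<noteq> 0}"
      by (rule negligible_subset[of "{0}"]) auto
  qed
  have J\<Phi>: "continuous_on S2 (\<lambda>x. J x * k (\<Phi> x))"
    by (intro continuous_intros J continuous_on_compose2[OF k \<Phi> im])
  have "integral ?S (radial k) = integral (?\<Psi> ` ?S) (radial k)"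
    by (simp only: onto)
  also have "\<dots> = integral ?S (\<lambda>x. \<bar>det (matrix (\<Psi>' x))\<bar> * radial k (?\<Psi> x))"
    by (rule integral_change_of_variables_real[OF S _ inj])
      (use ai in \<open>auto simp only: onto intro!: has_derivative_at_withinI[OF der]\<close>)
  also have "\<dots> = integral ?S (radial (\<lambda>x. J x * k (\<Phi> x)))"
  proof (rule integral_cong)
    fix x assume "x \<in> ?S"
    then have x: "x \<noteq> 0" by auto
    have "radial k (?\<Psi> x) = k (\<Phi> (x /\<^sub>R norm x))"
      using rad[OF x] x unfolding radial_def by simp
    then show "\<bar>det (matrix (\<Psi>' x))\<bar> * radial k (?\<Psi> x) = radial (\<lambda>x. J x * k (\<Phi> x)) x"
      using det[OF x] by (simp add: radial_def)
  qed
  finally show ?thesis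
    using area_S2_integral_ball[OF k] area_S2_integral_ball[OF J\<Phi>] by (simp add: ball)
qed

text \<open>The homogeneous extension of an orthogonal map is the map itself, with determinant of
  modulus one. The lemma serves to move a given point to the pole of the polar chart.\<close>

lemma area_S2_integral_orthogonal:
  fixes k :: "real ^ 3 \<Rightarrow> real"
  assumes R: "orthogonal_transformation R" and k: "continuous_on S2 k"
  shows "(\<integral>x. k (R x) \<partial>area_S2) = (\<integral>x. k x \<partial>area_S2)"
proof -
  have lin: "linear R" and norm: "\<And>x. norm (R x) = norm x"
    using R by (auto simp: orthogonal_transformation)
  have "(\<integral>x. 1 * k (R x) \<partial>area_S2) = (\<integral>x. k x \<partial>area_S2)"
  proof (rule area_S2_integral_lift[OF _ _ _ k])
    show "bij_betw R S2 S2"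
    proof (rule bij_betw_imageI)
      show "inj_on R S2"
        using orthogonal_transformation_inj[OF R] by (rule inj_on_subset) simp
      show "R ` S2 = S2"
      proof (intro equalityI subsetI)
        fix y assume y: "y \<in> S2"
        obtain x where "y = R x" using orthogonal_transformation_surj[OF R] by blast
        then show "y \<in> R ` S2" using y norm[of x] by auto
      qed (auto simp: norm)
    qed
    show "((\<lambda>x. norm x *\<^sub>R radial R x) has_derivative R) (at x)" if "x \<noteq> 0" for x
    proof (rule has_derivative_transform_within_open[of R])
      show "(R has_derivative R) (at x)"
        using lin by (simp add: linear_imp_has_derivative)
      show "open (- {0 :: real ^ 3})" by auto
      show "R y = norm y *\<^sub>R radial R y" if "y \<in> - {0}" for y
        using that by (simp add: radial_def linear_cmul[OF lin])
    qed (use that in auto)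
    show "\<bar>det (matrix R)\<bar> = 1"
      using orthogonal_transformation_det[OF R] by simp
    show "continuous_on S2 R"
      using lin by (simp add: linear_continuous_on linear_conv_bounded_linear)
  qed auto
  then show ?thesis by simp
qed

section \<open>Reflections and the explicit Moebius family\<close>

definition reflect :: "'a::real_inner \<Rightarrow> 'a \<Rightarrow> 'a" where
  "reflect u w = w - (2 * (w \<bullet> u) / (u \<bullet> u)) *\<^sub>R u"

lemma linear_reflect: "linear (reflect u)"
  by (rule linearI) (simp_all add: reflect_def inner_add_left algebra_simps add_divide_distrib)

lemma inner_reflect: "u \<noteq> 0 \<Longrightarrow> reflect u w \<bullet> reflect u z = w \<bullet> z"
  by (simp add: reflect_def inner_diff_left inner_diff_right inner_commute field_simps)

lemma inner_reflect_swap: "reflect u w \<bullet> z = w \<bullet> reflect u z"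
  by (simp add: reflect_def inner_diff_left inner_diff_right inner_commute)

text \<open>
  For \<open>norm a < 1\<close> these are conformal automorphisms of the unit sphere that move it towards \<open>a\<close>: the
  derivative at \<open>x\<close> is \<open>moebius_factor a x\<close> times the reflection in \<open>x + a\<close>. For \<open>norm a = 1\<close> the
  map is constantly \<open>a\<close>, including at \<open>x = - a\<close>, where the quotient is \<open>0 / 0 = 0\<close>.
\<close>

definition moebius_map :: "'a::real_inner \<Rightarrow> 'a \<Rightarrow> 'a" where
  "moebius_map a x = a + ((1 - a \<bullet> a) / ((x + a) \<bullet> (x + a))) *\<^sub>R (x + a)"

definition moebius_factor :: "'a::real_inner \<Rightarrow> 'a \<Rightarrow> real" where
  "moebius_factor a x = (1 - a \<bullet> a) / ((x + a) \<bullet> (x + a))"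

lemma moebius_eq: "moebius_map a x = a + moebius_factor a x *\<^sub>R (x + a)"
  by (simp add: moebius_map_def moebius_factor_def)

lemma moebius_denominator_nonzero:
  fixes a x :: "'a::real_inner"
  assumes "norm a < 1" "norm x = 1" shows "x + a \<noteq> 0"
  using assms by (metis add.inverse_unique less_irrefl norm_minus_cancel)

lemma moebius_factor_pos:
  assumes "norm a < 1" "norm x = 1" shows "moebius_factor a x > 0"
proof -
  have "a \<bullet> a < 1"
    using assms(1) by (metis abs_square_less_1 abs_norm_cancel power2_norm_eq_inner)
  then show ?thesis
    using moebius_denominator_nonzero[OF assms] by (simp add: moebius_factor_def)
qed

text \<open>For a unit vector, 2 x . (x + a) = |x + a|^2 + (1 - |a|^2). Hence the map preserves the
  sphere, and the reflection occurring in its derivative at \<open>x\<close> sends the normal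
  \<open>x\<close> to minus the image point.\<close>

lemma moebius_eq_reflect:
  fixes a x :: "'a::real_inner"
  assumes "norm x = 1" "x + a \<noteq> 0"
  shows "moebius_map a x = - reflect (x + a) x"
proof -
  let ?u = "x + a"
  have "x \<bullet> x = 1" using assms(1) by (simp add: norm_eq_sqrt_inner)
  then have "2 * (x \<bullet> ?u) = ?u \<bullet> ?u + (1 - a \<bullet> a)"
    by (simp add: inner_add_left inner_add_right inner_commute)
  moreover have "?u \<bullet> ?u \<noteq> 0" using assms(2) by simp
  ultimately have "2 * (x \<bullet> ?u) / (?u \<bullet> ?u) = 1 + moebius_factor a x"
    by (simp add: moebius_factor_def add_divide_distrib)
  then show ?thesis
    by (simp add: reflect_def moebius_eq algebra_simps)
qed

lemma norm_reflect: "u \<noteq> 0 \<Longrightarrow> norm (reflect u w) = norm w"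
  by (simp add: norm_eq_sqrt_inner inner_reflect)

lemma norm_moebius:
  assumes "norm x = 1" "x + a \<noteq> 0" shows "norm (moebius_map a x) = 1"
  using assms by (simp add: moebius_eq_reflect norm_reflect)

text \<open>Subtracting \<open>a\<close> from the image leaves c (x + a), c the factor at
  \<open>x\<close>. As 1 - |a|^2 = c |x + a|^2, the factor of the second map at the image is 1 / c,
  which restores x + a.\<close>

lemma moebius_inverse:
  assumes "norm a < 1" "norm x = 1" shows "moebius_map (- a) (moebius_map a x) = x"
proof -
  let ?u = "x + a" and ?c = "moebius_factor a x"
  have c: "?c > 0" by (rule moebius_factor_pos[OF assms])
  have u: "?u \<bullet> ?u \<noteq> 0" using moebius_denominator_nonzero[OF assms] by simp
  have eq: "moebius_map a x + - a = ?c *\<^sub>R ?u" by (simp add: moebius_eq)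
  have "moebius_map (- a) (moebius_map a x) = - a + ((1 - a \<bullet> a) / (?c * (?c * (?u \<bullet> ?u))) * ?c) *\<^sub>R ?u"
    by (simp only: moebius_map_def[of "- a"] eq inner_minus_left inner_minus_right minus_minus
        inner_scaleR_left inner_scaleR_right scaleR_scaleR)
  also have "(1 - a \<bullet> a) / (?c * (?c * (?u \<bullet> ?u))) * ?c = 1"
  proof -
    have e: "1 - a \<bullet> a = ?c * (?u \<bullet> ?u)" using u by (simp add: moebius_factor_def)
    show ?thesis unfolding e using c u by simp
  qed
  finally show ?thesis by simp
qed

lemma bij_betw_moebius:
  assumes "norm (a :: real ^ 3) < 1" shows "bij_betw (moebius_map a) S2 S2"
proof (rule bij_betw_byWitness[where f' = "moebius_map (- a)"])
  have im: "moebius_map b ` S2 \<subseteq> S2" if "norm b < 1" for b :: "real ^ 3"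
  proof (rule image_subsetI)
    fix x :: "real ^ 3" assume "x \<in> S2"
    then show "moebius_map b x \<in> S2"
      using norm_moebius[OF _ moebius_denominator_nonzero[OF that, of x]] by simp
  qed
  show "moebius_map a ` S2 \<subseteq> S2" "moebius_map (- a) ` S2 \<subseteq> S2"
    using im[of a] im[of "- a"] assms by auto
  show "\<forall>x\<in>S2. moebius_map (- a) (moebius_map a x) = x"
    using moebius_inverse[OF assms] by auto
  show "\<forall>x\<in>S2. moebius_map a (moebius_map (- a) x) = x"
    using moebius_inverse[of "- a"] assms by auto
qed

lemma moebius_in_S2: "norm a < 1 \<Longrightarrow> x \<in> S2 \<Longrightarrow> moebius_map a x \<in> S2" for a :: "real ^ 3"
  using bij_betw_moebius[of a] by (auto simp: bij_betw_def)

lemma smooth_S2_moebius_factor: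
  assumes "norm (a :: real ^ 3) < 1" shows "smooth_S2 (moebius_factor a)"
proof -
  have "smooth_S2 (\<lambda>x. inverse ((x + a) \<bullet> (x + a)))"
  proof (rule smooth_S2_compose_Ck_on[OF _ _ Ck_on_inverse_real])
    show "smooth_S2 (\<lambda>x. (x + a) \<bullet> (x + a))"
      by (intro smooth_S2_inner smooth_S2_add smooth_S2_id smooth_S2_const)
    show "(x + a) \<bullet> (x + a) \<in> {0<..}" if "x \<in> S2" for x
      using moebius_denominator_nonzero[OF assms, of x] that by simp
  qed simp
  then show ?thesis
    unfolding moebius_factor_def[abs_def] divide_inverse
    by (intro smooth_S2_mult smooth_S2_const)
qed

lemma smooth_S2_moebius:
  assumes "norm (a :: real ^ 3) < 1" shows "smooth_S2 (moebius_map a)"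
  unfolding moebius_eq[abs_def]
  by (intro smooth_S2_add smooth_S2_scaleR smooth_S2_moebius_factor[OF assms] smooth_S2_id smooth_S2_const)

text \<open>With u = x + a, differentiating the factor contributes -2 c (v . u) / |u|^2 times u,
  which is just what turns c v into c times a reflection.\<close>

lemma has_derivative_moebius:
  fixes a x :: "'a::real_inner"
  assumes "x + a \<noteq> 0"
  shows "(moebius_map a has_derivative (\<lambda>v. moebius_factor a x *\<^sub>R reflect (x + a) v)) (at x)"
proof -
  let ?u = "x + a"
  have "?u \<bullet> ?u \<noteq> 0" using assms by simp
  then have "(moebius_factor a has_derivative
      (\<lambda>v. - (2 * (v \<bullet> ?u)) * moebius_factor a x / (?u \<bullet> ?u))) (at x)"
    unfolding moebius_factor_def[abs_def]
    by (auto intro!: derivative_eq_intros simp: fun_eq_iff inner_commute field_simps)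
  note D = has_derivative_add[OF has_derivative_const
      has_derivative_scaleR[OF this has_derivative_add[OF has_derivative_ident has_derivative_const]]]
  show ?thesis
    unfolding moebius_eq[abs_def]
    by (rule has_derivative_eq_rhs[OF D]) (simp add: fun_eq_iff reflect_def scaleR_diff_right mult.commute)
qed

lemma has_derivative_radial_moebius:
  fixes a x :: "real ^ 3"
  assumes "norm a < 1" "x \<noteq> 0"
  defines "y \<equiv> x /\<^sub>R norm x"
  shows "(radial (moebius_map a) has_derivative
    (\<lambda>v. moebius_factor a y *\<^sub>R reflect (y + a) ((v - (v \<bullet> y) *\<^sub>R y) /\<^sub>R norm x))) (at x)"
proof -
  have "y + a \<noteq> 0"
    using moebius_denominator_nonzero[OF assms(1), of y] normalize_in_S2[OF assms(2)] by (simp add: y_def)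
  from has_derivative_compose[OF has_derivative_normalize[OF assms(2)] has_derivative_moebius[OF this, unfolded y_def]]
  show ?thesis
    by (simp add: radial_def[abs_def] y_def)
qed

text \<open>Orthogonally to \<open>y\<close> the map is multiplication by \<open>c\<close>; on
  \<open>y\<close> it is multiplication by \<open>c - d * (y \<bullet> y)\<close>.\<close>

lemma det_scale_rank_one:
  fixes y :: "real ^ 3"
  shows "det (matrix (\<lambda>v. c *\<^sub>R v - (d * (v \<bullet> y)) *\<^sub>R y)) = c\<^sup>2 * (c - d * (y \<bullet> y))"
  unfolding det_3 matrix_def
  by (simp add: axis_def inner_vec_def sum_3 power2_eq_square algebra_simps)

lemma area_S2_integral_moebius:
  fixes k :: "real ^ 3 \<Rightarrow> real"
  assumes a: "norm a < 1" and k: "continuous_on S2 k"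
  shows "(\<integral>x. (moebius_factor a x)\<^sup>2 * k (moebius_map a x) \<partial>area_S2) = (\<integral>x. k x \<partial>area_S2)"
proof (rule area_S2_integral_lift[OF bij_betw_moebius[OF a] _ _ k])
  show "continuous_on S2 (moebius_map a)"
    by (rule smooth_S2_continuous_on[OF smooth_S2_moebius[OF a]])
  show "continuous_on S2 (\<lambda>x. (moebius_factor a x)\<^sup>2)"
    by (intro continuous_intros smooth_S2_continuous_on[OF smooth_S2_moebius_factor[OF a]])
  fix x :: "real ^ 3" assume x: "x \<noteq> 0"
  define y where "y = x /\<^sub>R norm x"
  let ?c = "moebius_factor a y" and ?R = "reflect (y + a)"
  \<comment> \<open>\<open>?L\<close> scales tangent vectors by \<open>?c\<close> and sends
    \<open>y\<close> to \<open>- y\<close>. Since the image of \<open>y\<close> is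
    \<open>- ?R y\<close>, the composite of \<open>?R\<close> and \<open>?L\<close> has the right
    tangential part and maps the radial direction to the image point; its determinant has modulus
    \<open>?c\<^sup>2\<close>.\<close>
  let ?L = "\<lambda>v. ?c *\<^sub>R v - ((1 + ?c) * (v \<bullet> y)) *\<^sub>R y"
  have y: "norm y = 1" using x by (simp add: y_def)
  then have yy: "y \<bullet> y = 1" by (simp add: norm_eq_sqrt_inner)
  have u: "y + a \<noteq> 0" by (rule moebius_denominator_nonzero[OF a y])
  have \<Phi>: "moebius_map a y = - ?R y" by (rule moebius_eq_reflect[OF y u])
  have R: "linear ?R" by (rule linear_reflect)
  have L: "linear ?L" by (rule linearI) (simp_all add: inner_add_left algebra_simps)
  show "((\<lambda>x. norm x *\<^sub>R radial (moebius_map a) x) has_derivative ?R \<circ> ?L) (at x)"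
  proof (rule has_derivative_eq_rhs[OF has_derivative_scaleR[OF has_derivative_norm[OF x]
          has_derivative_radial_moebius[OF a x]]], rule ext, fold y_def)
    fix v
    have 1: "?R ((v - (v \<bullet> y) *\<^sub>R y) /\<^sub>R norm x) = (?R v - (v \<bullet> y) *\<^sub>R ?R y) /\<^sub>R norm x"
      by (simp only: linear_cmul[OF R] linear_diff[OF R])
    have 2: "(?R \<circ> ?L) v = ?c *\<^sub>R ?R v - ((1 + ?c) * (v \<bullet> y)) *\<^sub>R ?R y"
      by (simp only: o_def linear_cmul[OF R] linear_diff[OF R])
    have 3: "radial (moebius_map a) x = - ?R y" "sgn x = y"
      by (simp_all add: radial_def sgn_div_norm \<Phi> flip: y_def)
    show "norm x *\<^sub>R ?c *\<^sub>R ?R ((v - (v \<bullet> y) *\<^sub>R y) /\<^sub>R norm x) + (v \<bullet> sgn x) *\<^sub>R radial (moebius_map a) x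
      = (?R \<circ> ?L) v"
    proof -
      have "norm x *\<^sub>R ?c *\<^sub>R (z /\<^sub>R norm x) = ?c *\<^sub>R z" for z :: "real ^ 3"
        using x by simp
      note eq = this
      show ?thesis unfolding 1 2 3 eq by (simp add: algebra_simps)
    qed
  qed
  have "orthogonal_transformation ?R"
    unfolding orthogonal_transformation_def using R inner_reflect[OF u] by auto
  then have "\<bar>det (matrix ?R)\<bar> = 1"
    by (rule orthogonal_transformation_det)
  moreover have "det (matrix ?L) = - ?c\<^sup>2"
    unfolding det_scale_rank_one by (simp add: yy)
  ultimately show "\<bar>det (matrix (?R \<circ> ?L))\<bar> = (moebius_factor a (x /\<^sub>R norm x))\<^sup>2"
    by (simp add: matrix_compose[OF L R] det_mul abs_mult flip: y_def)
qed

lemma grad_S2_moebius: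
  fixes a x :: "real ^ 3"
  assumes a: "norm a < 1" and u: "smooth_S2 u" and x: "x \<in> S2"
  shows "grad_S2 (\<lambda>x. u (moebius_map a x)) x
    = moebius_factor a x *\<^sub>R reflect (x + a) (grad_S2 u (moebius_map a x))"
proof (rule grad_S2_eqI)
  let ?c = "moebius_factor a x" and ?R = "reflect (x + a)" and ?g = "grad_S2 u (moebius_map a x)"
  have nx: "norm x = 1" "x \<noteq> 0" "x /\<^sub>R norm x = x" using x by auto
  have ux: "x + a \<noteq> 0" by (rule moebius_denominator_nonzero[OF a nx(1)])
  have \<Phi>x: "moebius_map a x \<in> S2" by (rule moebius_in_S2[OF a x])
  have "?g \<bullet> moebius_map a x = 0"
    using grad_S2_orthogonal[OF u S2_nonzero[OF \<Phi>x]] .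
  \<comment> \<open>The reflection is self-adjoint and takes the normal at \<open>x\<close> to minus
    the normal at the image, so it carries the tangent vector \<open>?g\<close> back to one tangent
    at \<open>x\<close>. The radial projection in the derivative then has no effect.\<close>
  then have orth: "x \<bullet> ?R ?g = 0"
    using moebius_eq_reflect[OF nx(1) ux] inner_reflect_swap[of "x + a" x ?g]
    by (simp add: inner_commute)
  have "(radial u has_derivative (\<lambda>h. h \<bullet> ?g)) (at (radial (moebius_map a) x))"
    using smooth_S2_GDERIV[OF u S2_nonzero[OF \<Phi>x]] radial_on_S2[OF x, of "moebius_map a"] by (simp add: gderiv_def)
  from has_derivative_compose[OF has_derivative_radial_moebius[OF a nx(2)] this]
  have "((\<lambda>z. radial u (radial (moebius_map a) z)) has_derivative
      (\<lambda>h. (?c *\<^sub>R ?R (h - (h \<bullet> x) *\<^sub>R x)) \<bullet> ?g)) (at x)"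
    using nx by simp
  moreover have "(?c *\<^sub>R ?R (h - (h \<bullet> x) *\<^sub>R x)) \<bullet> ?g = h \<bullet> (?c *\<^sub>R ?R ?g)" for h
    using orth by (simp add: inner_reflect_swap inner_diff_left)
  then have eq: "(\<lambda>h. (?c *\<^sub>R ?R (h - (h \<bullet> x) *\<^sub>R x)) \<bullet> ?g) = (\<lambda>h. h \<bullet> (?c *\<^sub>R ?R ?g))"
    by (rule ext)
  ultimately have "((\<lambda>z. radial u (radial (moebius_map a) z)) has_derivative
      (\<lambda>h. h \<bullet> (?c *\<^sub>R ?R ?g))) (at x)"
    by (simp only: eq)
  then have "(radial (\<lambda>x. u (moebius_map a x)) has_derivative (\<lambda>h. h \<bullet> (?c *\<^sub>R ?R ?g))) (at x)"
  proof (rule has_derivative_transform_within_open)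
    show "open (- {0 :: real ^ 3})" by auto
    show "radial u (radial (moebius_map a) z) = radial (\<lambda>x. u (moebius_map a x)) z" if "z \<in> - {0}" for z
      using moebius_in_S2[OF a normalize_in_S2[of z]] that by (simp add: radial_def)
  qed (use nx in auto)
  then show "GDERIV (radial (\<lambda>x. u (moebius_map a x))) x :> ?c *\<^sub>R ?R ?g"
    by (simp add: gderiv_def)
qed

section \<open>Conformal invariance of the Dirichlet energy\<close>

definition dirichlet_energy :: "(real ^ 3 \<Rightarrow> real) \<Rightarrow> real" where
  "dirichlet_energy u = (\<integral>x. (norm (grad_S2 u x))\<^sup>2 \<partial>area_S2)"

lemma continuous_on_norm_grad_S2:
  "smooth_S2 u \<Longrightarrow> continuous_on S2 (\<lambda>x. (norm (grad_S2 u x))\<^sup>2)"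
  by (intro continuous_intros continuous_on_subset[OF continuous_on_grad_S2]) auto

text \<open>This is special to dimension two: the squared gradient and the area element both scale
  by the square of the conformal factor.\<close>

lemma dirichlet_energy_moebius:
  assumes a: "norm a < 1" and u: "smooth_S2 u"
  shows "dirichlet_energy (\<lambda>x. u (moebius_map a x)) = dirichlet_energy u"
proof -
  have "dirichlet_energy (\<lambda>x. u (moebius_map a x))
      = (\<integral>x. (moebius_factor a x)\<^sup>2 * (norm (grad_S2 u (moebius_map a x)))\<^sup>2 \<partial>area_S2)"
    unfolding dirichlet_energy_def
  proof (rule Bochner_Integration.integral_cong[OF refl])
    fix x assume "x \<in> space area_S2"
    then have x: "x \<in> S2" by (simp add: space_area_S2)
    then have "x + a \<noteq> 0" using moebius_denominator_nonzero[OF a] by simp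
    then show "(norm (grad_S2 (\<lambda>x. u (moebius_map a x)) x))\<^sup>2
        = (moebius_factor a x)\<^sup>2 * (norm (grad_S2 u (moebius_map a x)))\<^sup>2"
      by (simp add: grad_S2_moebius[OF a u x] norm_reflect power_mult_distrib)
  qed
  also have "\<dots> = dirichlet_energy u"
    unfolding dirichlet_energy_def
    by (rule area_S2_integral_moebius[OF a continuous_on_norm_grad_S2[OF u]])
  finally show ?thesis .
qed

lemma conformal_automorphism_moebius:
  assumes a: "norm (a :: real ^ 3) < 1" shows "conformal_automorphism (moebius_map a)"
  unfolding conformal_automorphism_def
proof (intro conjI ballI)
  show bij: "bij_betw (moebius_map a) S2 S2" by (rule bij_betw_moebius[OF a])
  show "smooth_S2 (moebius_map a)" by (rule smooth_S2_moebius[OF a])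
  show "smooth_S2 (inv_into S2 (moebius_map a))"
  proof (rule smooth_S2_cong)
    show "smooth_S2 (moebius_map (- a))" using a by (intro smooth_S2_moebius) simp
    show "moebius_map (- a) x = inv_into S2 (moebius_map a) x" if "x \<in> S2" for x
    proof -
      have m: "moebius_map (- a) x \<in> S2" using a that by (intro moebius_in_S2) auto
      have "moebius_map a (moebius_map (- a) x) = x" using moebius_inverse[of "- a" x] a that by simp
      then show ?thesis
        using inv_into_f_f[OF bij_betw_imp_inj_on[OF bij] m] by simp
    qed
  qed
  fix x :: "real ^ 3" assume x: "x \<in> S2"
  then have nx: "norm x = 1" "x \<noteq> 0" "x /\<^sub>R norm x = x" by auto
  have u: "x + a \<noteq> 0" by (rule moebius_denominator_nonzero[OF a nx(1)])
  have d: "diff_S2 (moebius_map a) x v = moebius_factor a x *\<^sub>R reflect (x + a) v" if "v \<bullet> x = 0" for v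
    using fun_cong[OF frechet_derivative_at[OF has_derivative_radial_moebius[OF a nx(2)]], of v] nx that
    by (simp add: diff_S2_def)
  show "\<exists>\<rho>>0. \<forall>v w. v \<bullet> x = 0 \<longrightarrow> w \<bullet> x = 0 \<longrightarrow>
      diff_S2 (moebius_map a) x v \<bullet> diff_S2 (moebius_map a) x w = \<rho> * (v \<bullet> w)"
    using moebius_factor_pos[OF a nx(1)]
    by (intro exI[of _ "(moebius_factor a x)\<^sup>2"]) (auto simp: d inner_reflect[OF u] power2_eq_square)
qed

section \<open>The variational inequality and its consequences\<close>

lemma nonzero_radon_S2_D:
  assumes "nonzero_radon_S2 M"
  shows "sets M = sets borel_S2" "space M = S2" "finite_measure M" "measure M S2 > 0"
proof -
  show 1: "sets M = sets borel_S2" and 2: "finite_measure M"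
    using assms by (auto simp: nonzero_radon_S2_def)
  show "space M = S2"
    using sets_eq_imp_space_eq[OF 1] by (simp add: space_restrict_space)
  show "measure M S2 > 0"
    using assms finite_measure.emeasure_eq_measure[OF 2, of S2]
    by (auto simp: nonzero_radon_S2_def zero_less_measure_iff)
qed

lemma integrable_continuous_on_S2:
  fixes k :: "real ^ 3 \<Rightarrow> 'b::{banach, second_countable_topology}"
  assumes "sets M = sets borel_S2" "finite_measure M" "continuous_on S2 k"
  shows "integrable M k"
proof -
  have "bounded (k ` S2)"
    using compact_imp_bounded[OF compact_continuous_image[OF assms(3)]] by simp
  then obtain B where B: "\<forall>y\<in>k ` S2. norm y \<le> B"
    unfolding bounded_iff by blast
  have "space M = S2"
    using sets_eq_imp_space_eq[OF assms(1)] by (simp add: space_restrict_space)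
  then have "AE x in M. norm (k x) \<le> B"
    using B by (intro AE_I2) auto
  moreover have "k \<in> borel_measurable M"
    using continuous_on_S2_measurable[OF assms(3)] measurable_cong_sets[OF assms(1) refl] by blast
  ultimately show ?thesis
    using finite_measure.integrable_const_bound[OF assms(2)] by blast
qed

lemma integrable_area_S2: "continuous_on S2 k \<Longrightarrow> integrable area_S2 k"
  for k :: "real ^ 3 \<Rightarrow> 'b::{banach, second_countable_topology}"
  by (rule integrable_continuous_on_S2[OF sets_area_S2 finite_measure_area_S2])

text \<open>The second claim is the Cauchy-Schwarz inequality against constants, read off from the
  first by expanding the integral of (w - mean)^2.\<close>

lemma
  fixes w :: "'a \<Rightarrow> real"
  assumes "finite_measure M" "measure M (space M) > 0" "integrable M w" "integrable M (\<lambda>x. (w x)\<^sup>2)"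
  shows integral_square_affine: "(\<integral>x. (c + d * w x)\<^sup>2 \<partial>M) = c\<^sup>2 * measure M (space M) + 2 * c * d * (\<integral>x. w x \<partial>M) + d\<^sup>2 * (\<integral>x. (w x)\<^sup>2 \<partial>M)"
    and square_integral_le: "(\<integral>x. w x \<partial>M)\<^sup>2 / measure M (space M) \<le> (\<integral>x. (w x)\<^sup>2 \<partial>M)"
proof -
  interpret finite_measure M by fact
  let ?m = "measure M (space M)" and ?I = "\<integral>x. w x \<partial>M" and ?Q = "\<integral>x. (w x)\<^sup>2 \<partial>M"
  have *: "(\<integral>x. (c + d * w x)\<^sup>2 \<partial>M) = c\<^sup>2 * ?m + 2 * c * d * ?I + d\<^sup>2 * ?Q" for c d
  proof -
    have eq: "(c + d * w x)\<^sup>2 = c\<^sup>2 + (2 * c * d) * w x + d\<^sup>2 * (w x)\<^sup>2" for x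
      by (simp add: power2_eq_square algebra_simps)
    show ?thesis
      unfolding eq using assms(3,4) by (simp add: algebra_simps)
  qed
  show "(\<integral>x. (c + d * w x)\<^sup>2 \<partial>M) = c\<^sup>2 * ?m + 2 * c * d * ?I + d\<^sup>2 * ?Q" by (rule *)
  have "0 \<le> (\<integral>x. (- (?I / ?m) + 1 * w x)\<^sup>2 \<partial>M)" by simp
  then have "0 \<le> (?I / ?m)\<^sup>2 * ?m - 2 * (?I / ?m) * ?I + ?Q"
    unfolding * by simp
  moreover have "(?I / ?m)\<^sup>2 * ?m = ?I\<^sup>2 / ?m" "2 * (?I / ?m) * ?I = 2 * (?I\<^sup>2 / ?m)"
    using assms(2) by (simp_all add: power2_eq_square)
  ultimately show "?I\<^sup>2 / ?m \<le> ?Q" by linarith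
qed

lemma dirichlet_energy_affine:
  assumes "smooth_S2 u"
  shows "dirichlet_energy (\<lambda>x. c + d * u x) = d\<^sup>2 * dirichlet_energy u"
proof -
  have "grad_S2 (\<lambda>x. c + d * u x) x = d *\<^sub>R grad_S2 u x" if "x \<in> S2" for x
  proof (rule grad_S2_real_compose[OF assms that])
    show "((\<lambda>t. c + d * t) has_real_derivative d) (at (u x))"
      by (auto intro!: derivative_eq_intros)
  qed
  then have "dirichlet_energy (\<lambda>x. c + d * u x) = (\<integral>x. d\<^sup>2 * (norm (grad_S2 u x))\<^sup>2 \<partial>area_S2)"
    unfolding dirichlet_energy_def
    by (intro Bochner_Integration.integral_cong) (auto simp: space_area_S2 power_mult_distrib)
  then show ?thesis
    by (simp add: dirichlet_energy_def)
qed

lemma dirichlet_energy_nonneg: "dirichlet_energy u \<ge> 0"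
  by (simp add: dirichlet_energy_def)

text \<open>The test space is the span of 1 and \<open>u\<close>. Adding a constant leaves the
  energy unchanged, and the square integral is smallest at mean zero, so \<open>V\<close> is the
  worst denominator. Positivity of \<open>V\<close> makes the span two-dimensional in
  L^2(M).\<close>

lemma eigenvalue_S2_1_le:
  assumes M: "nonzero_radon_S2 M" and u: "smooth_S2 u"
  defines "V \<equiv> (\<integral>x. (u x)\<^sup>2 \<partial>M) - (\<integral>x. u x \<partial>M)\<^sup>2 / measure M S2"
  assumes V: "V > 0"
  shows "eigenvalue_S2 1 M \<le> ereal (dirichlet_energy u / V)"
proof -
  note M' = nonzero_radon_S2_D[OF M]
  let ?m = "measure M S2" and ?I = "\<integral>x. u x \<partial>M" and ?Q = "\<integral>x. (u x)\<^sup>2 \<partial>M"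
  have cu: "continuous_on S2 u" by (rule smooth_S2_continuous_on[OF u])
  have iu: "integrable M u" "integrable M (\<lambda>x. (u x)\<^sup>2)"
    by (intro integrable_continuous_on_S2[OF M'(1,3)] continuous_intros cu)+
  have sq: "(\<integral>x. (c + d * u x)\<^sup>2 \<partial>M) = c\<^sup>2 * ?m + 2 * c * d * ?I + d\<^sup>2 * ?Q" for c d
    using integral_square_affine[OF M'(3) _ iu] M' by simp
  have sqV: "(\<integral>x. (c + d * u x)\<^sup>2 \<partial>M) = (c + d * ?I / ?m)\<^sup>2 * ?m + d\<^sup>2 * V" for c d
    unfolding sq V_def using M'(4) by (simp add: power2_eq_square field_simps)
  define E where "E = {f. \<exists>c d. f = (\<lambda>x. c + d * u x)}"
  have smooth: "smooth_S2 (\<lambda>x. c + d * u x)" for c d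
    by (intro smooth_S2_add smooth_S2_mult smooth_S2_const u)
  have lin: "linear_subspace E"
    unfolding linear_subspace_def
  proof (intro conjI ballI allI)
    show "(\<lambda>x. 0) \<in> E"
      unfolding E_def by (auto intro!: exI[of _ 0])
  next
    fix f g assume "f \<in> E" "g \<in> E"
    then obtain c d c' d' where "f = (\<lambda>x. c + d * u x)" "g = (\<lambda>x. c' + d' * u x)"
      unfolding E_def by blast
    then have "(\<lambda>x. f x + g x) = (\<lambda>x. (c + c') + (d + d') * u x)"
      by (auto simp: algebra_simps)
    then show "(\<lambda>x. f x + g x) \<in> E" unfolding E_def by blast
  next
    fix k f assume "f \<in> E"
    then obtain c d where "f = (\<lambda>x. c + d * u x)"
      unfolding E_def by blast
    then have "(\<lambda>x. k * f x) = (\<lambda>x. (k * c) + (k * d) * u x)"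
      by (auto simp: algebra_simps)
    then show "(\<lambda>x. k * f x) \<in> E" unfolding E_def by blast
  qed
  have indep: "c = 0 \<and> d = 0" if "AE x in M. c + d * u x = 0" for c d
  proof -
    have "(\<lambda>x. (c + d * u x)\<^sup>2) \<in> borel_measurable M"
      using borel_measurable_integrable[OF iu(1)] by measurable
    then have "(\<integral>x. (c + d * u x)\<^sup>2 \<partial>M) = (\<integral>x. 0 \<partial>M)"
      using that by (intro integral_cong_AE) auto
    then have z: "(c + d * ?I / ?m)\<^sup>2 * ?m + d\<^sup>2 * V = 0"
      using sqV[of c d] by simp
    have "d\<^sup>2 * V \<ge> 0" "(c + d * ?I / ?m)\<^sup>2 * ?m \<ge> 0" using V M'(4) by simp_all
    with z have "d\<^sup>2 * V = 0" "(c + d * ?I / ?m)\<^sup>2 * ?m = 0" by linarith+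
    then show ?thesis using V M'(4) by simp
  qed
  let ?b = "\<lambda>i::nat. if i = 0 then (\<lambda>x. 1) else u"
  have sum2: "(\<Sum>i<2. c i * ?b i x) = c 0 + c 1 * u x" for c :: "nat \<Rightarrow> real" and x
    by (simp add: numeral_2_eq_2)
  \<comment> \<open>Kept generic in the null relation, to serve both dimension conditions of
    \<open>test_spaces\<close>; vanishing on the sphere implies vanishing almost everywhere, so
    \<open>indep\<close> handles both.\<close>
  have dim: "has_dim_mod nl 2 E"
    if "nl (\<lambda>x. 0)" "\<And>c d. nl (\<lambda>x. c + d * u x) \<Longrightarrow> c = 0 \<and> d = 0"
    for nl :: "(real ^ 3 \<Rightarrow> real) \<Rightarrow> bool"
    unfolding has_dim_mod_def
  proof (intro exI[of _ ?b] conjI allI impI ballI)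
    fix i :: nat
    have "(\<lambda>x. 1) = (\<lambda>x. 1 + 0 * u x)" "u = (\<lambda>x. 0 + 1 * u x)" by auto
    then have "(\<lambda>x. 1) \<in> E" "u \<in> E" unfolding E_def by blast+
    then show "?b i \<in> E" by simp
  next
    fix c :: "nat \<Rightarrow> real" and i :: nat
    assume "nl (\<lambda>x. \<Sum>i<2. c i * ?b i x)" "i < 2"
    then have "c 0 = 0 \<and> c 1 = 0" using that(2) by (simp only: sum2)
    then show "c i = 0" using \<open>i < 2\<close> by (auto simp: less_2_cases_iff)
  next
    fix f assume "f \<in> E"
    then obtain c d where f: "f = (\<lambda>x. c + d * u x)"
      unfolding E_def by blast
    show "\<exists>c. nl (\<lambda>x. f x - (\<Sum>i<2. c i * ?b i x))"
      by (rule exI[of _ "\<lambda>i. if i = 0 then c else d"]) (simp only: sum2, simp add: f that(1))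
  qed
  have "E \<in> test_spaces (1 + 1) M"
    unfolding test_spaces_def mem_Collect_eq
  proof (intro conjI)
    show "linear_subspace E" by (rule lin)
    show "E \<subseteq> {f. smooth_S2 f}" using smooth unfolding E_def by auto
    show "has_dim_mod (\<lambda>f. \<forall>x\<in>S2. f x = 0) (1 + 1) E"
      unfolding one_add_one
    proof (rule dim)
      show "c = 0 \<and> d = 0" if "\<forall>x\<in>S2. c + d * u x = 0" for c d
        using that M'(2) by (intro indep AE_I2) simp
    qed simp
    show "has_dim_mod (\<lambda>f. AE x in M. f x = 0) (1 + 1) E"
      unfolding one_add_one by (rule dim) (simp, rule indep)
  qed
  then have "eigenvalue_S2 1 M \<le> (SUP f \<in> {f \<in> E. \<exists>x\<in>S2. f x \<noteq> 0}.
        ereal ((\<integral>x. (norm (grad_S2 f x))\<^sup>2 \<partial>area_S2) / (\<integral>x. (f x)\<^sup>2 \<partial>M)))"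
    unfolding eigenvalue_S2_def by (rule INF_lower)
  also have "\<dots> \<le> ereal (dirichlet_energy u / V)"
  proof (rule SUP_least)
    fix f assume "f \<in> {f \<in> E. \<exists>x\<in>S2. f x \<noteq> 0}"
    then obtain c d where f: "f = (\<lambda>x. c + d * u x)"
      unfolding E_def by blast
    have e: "(\<integral>x. (norm (grad_S2 f x))\<^sup>2 \<partial>area_S2) = d\<^sup>2 * dirichlet_energy u"
      using dirichlet_energy_affine[OF u, of c d] by (simp add: f dirichlet_energy_def)
    have q: "(\<integral>x. (f x)\<^sup>2 \<partial>M) \<ge> d\<^sup>2 * V"
      using sqV[of c d] M'(4) by (simp add: f)
    have "d\<^sup>2 * dirichlet_energy u / (\<integral>x. (f x)\<^sup>2 \<partial>M) \<le> dirichlet_energy u / V"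
    proof (cases "d = 0")
      case True
      then show ?thesis using dirichlet_energy_nonneg V by simp
    next
      case False
      then have dV: "0 < d\<^sup>2 * V" using V by simp
      have "d\<^sup>2 * dirichlet_energy u / (\<integral>x. (f x)\<^sup>2 \<partial>M) \<le> d\<^sup>2 * dirichlet_energy u / (d\<^sup>2 * V)"
        using dirichlet_energy_nonneg[of u]
        by (intro divide_left_mono q mult_pos_pos[OF less_le_trans[OF dV q] dV]) simp
      then show ?thesis using False by simp
    qed
    then show "ereal ((\<integral>x. (norm (grad_S2 f x))\<^sup>2 \<partial>area_S2) / (\<integral>x. (f x)\<^sup>2 \<partial>M))
        \<le> ereal (dirichlet_energy u / V)"
      by (simp add: e)
  qed
  finally show ?thesis .
qed

lemma dirichlet_energy_ge_variance:
  assumes M: "nonzero_radon_S2 M" and ev: "eigenvalue_S2 1 M = 2" and u: "smooth_S2 u"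
  shows "2 * ((\<integral>x. (u x)\<^sup>2 \<partial>M) - (\<integral>x. u x \<partial>M)\<^sup>2 / measure M S2) \<le> dirichlet_energy u"
    (is "2 * ?V \<le> _")
proof (cases "?V > 0")
  case True
  have "ereal 2 \<le> ereal (dirichlet_energy u / ?V)"
    using eigenvalue_S2_1_le[OF M u True] ev by simp
  then show ?thesis
    using True by (simp add: pos_le_divide_eq)
next
  case False
  then have "?V \<le> 0" by simp
  then show ?thesis using dirichlet_energy_nonneg[of u] mult_nonneg_nonpos[of 2 ?V] by simp
qed

text \<open>If all mass sat at one point, L^2(M) would be one-dimensional, there would be no
  two-dimensional test space, and the infimum over the empty set would be infinite. The cutoff
  argument below cannot see this case, since every function then has variance zero.\<close>

lemma not_Dirac_S2:
  assumes M: "nonzero_radon_S2 M" and ev: "eigenvalue_S2 1 M \<noteq> \<infinity>" and p: "p \<in> S2"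
  shows "measure M {p} \<noteq> measure M S2"
proof
  assume eq: "measure M {p} = measure M S2"
  note M' = nonzero_radon_S2_D[OF M]
  interpret finite_measure M by (rule M'(3))
  have pM: "{p} \<in> sets M"
    unfolding M'(1) using p by (auto simp: sets_restrict_space_iff)
  have "measure M (space M - {p}) = 0"
    using finite_measure_compl[OF pM] eq M'(2) by simp
  then have "space M - {p} \<in> null_sets M"
    using pM by (auto simp: null_sets_def emeasure_eq_measure)
  then have ae: "AE x in M. x = p"
    by (rule AE_I') auto
  have "test_spaces (1 + 1) M \<noteq> {}"
    using ev unfolding eigenvalue_S2_def by (auto simp: top_ereal_def)
  then obtain E where "has_dim_mod (\<lambda>f. AE x in M. f x = 0) 2 E"
    unfolding test_spaces_def one_add_one by blast
  then obtain b where b: "\<And>c. AE x in M. (\<Sum>i<2. c i * b i x) = 0 \<Longrightarrow> \<forall>i<2::nat. c i = (0::real)"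
    unfolding has_dim_mod_def by blast
  have z: "c 0 = 0 \<and> c 1 = 0" if "c 0 * b 0 p + c 1 * b 1 p = 0" for c :: "nat \<Rightarrow> real"
  proof -
    have p0: "(\<Sum>i<2. c i * b i p) = 0" using that by (simp add: numeral_2_eq_2)
    have "AE x in M. (\<Sum>i<2. c i * b i x) = 0"
      by (rule AE_mp[OF ae AE_I2], rule impI) (simp only: p0)
    from b[OF this] show ?thesis by simp
  qed
  \<comment> \<open>Two scalars are always dependent: the coefficients \<open>b 1 p\<close> and
    \<open>- b 0 p\<close> give a vanishing combination. Both values are then zero, and so even the
    coefficients 1, 1 give a relation.\<close>
  have "b 1 p = 0 \<and> b 0 p = 0"
    using z[of "\<lambda>i. if i = 0 then b 1 p else - b 0 p"] by simp
  then show False using z[of "\<lambda>i. 1"] by simp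
qed

text \<open>After a rotation of \<open>p\<close> to the pole the integrand depends on the polar
  angle alone, and sin t / (1 + \<epsilon> - cos t) has the primitive ln (1 + \<epsilon> - cos t).
  The value grows only logarithmically in 1 / \<epsilon>, which makes the cutoff energies
  small.\<close>

lemma area_S2_integral_log:
  assumes \<epsilon>: "\<epsilon> > 0" and p: "p \<in> S2"
  shows "(\<integral>x. 1 / (1 + \<epsilon> - x \<bullet> p) \<partial>area_S2) = 2 * pi * (ln (2 + \<epsilon>) - ln \<epsilon>)"
proof -
  let ?e = "axis 3 1 :: real ^ 3" and ?k = "\<lambda>x :: real ^ 3. 1 / (1 + \<epsilon> - x $ 3)"
  let ?f = "\<lambda>t. sin t / (1 + \<epsilon> - cos t)"
  have x3: "x $ 3 \<le> 1" if "x \<in> S2" for x :: "real ^ 3"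
    using component_le_norm_cart[of x 3] that by simp
  have k: "continuous_on S2 ?k"
  proof (intro continuous_intros ballI)
    fix x :: "real ^ 3" assume "x \<in> S2"
    from x3[OF this] show "1 + \<epsilon> - x $ 3 \<noteq> 0" using \<epsilon> by simp
  qed
  have pos: "1 + \<epsilon> - cos t > 0" for t
    using cos_le_one[of t] \<epsilon> by linarith
  obtain R where R: "orthogonal_transformation R" "R p = ?e"
    using rotation_exists_1[of p ?e] p by (auto simp: norm_axis_1)
  have "x \<bullet> p = R x $ 3" for x
  proof -
    have "x \<bullet> p = R x \<bullet> R p" using R(1) by (simp add: orthogonal_transformation_def)
    then show ?thesis by (simp add: R(2) inner_axis)
  qed
  then have "(\<integral>x. 1 / (1 + \<epsilon> - x \<bullet> p) \<partial>area_S2) = (\<integral>x. ?k (R x) \<partial>area_S2)"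
    by simp
  also have "\<dots> = (\<integral>x. ?k x \<partial>area_S2)"
    by (rule area_S2_integral_orthogonal[OF R(1) k])
  also have "\<dots> = (\<integral>z. indicator polar_domain z *\<^sub>R ?f (fst z) \<partial>lborel)"
    unfolding area_S2_integral_polar[OF k] by (simp add: case_prod_unfold polar_def)
  also have "\<dots> = (\<integral>z. indicator polar_domain z *\<^sub>R ?f (fst z) \<partial>(lborel \<Otimes>\<^sub>M lborel))"
    by (simp add: lborel_prod)
  also have "\<dots> = (\<integral>\<theta>. (\<integral>\<phi>. indicator polar_domain (\<theta>, \<phi>) *\<^sub>R ?f \<theta> \<partial>lborel) \<partial>lborel)"
  proof (subst lborel_pair.integral_fst'[symmetric])
    have "integrable lborel (\<lambda>z :: real \<times> real. indicator polar_domain z *\<^sub>R ?f (fst z))"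
    proof (rule borel_integrable_compact)
      show "compact polar_domain" by (simp add: compact_Times)
      show "continuous_on polar_domain (\<lambda>z. ?f (fst z))"
        using pos by (intro continuous_intros) (auto simp: less_imp_neq[symmetric])
    qed
    then show "integrable (lborel \<Otimes>\<^sub>M lborel) (\<lambda>z :: real \<times> real. indicator polar_domain z *\<^sub>R ?f (fst z))"
      by (simp add: lborel_prod)
  qed simp
  also have "\<dots> = (\<integral>\<theta>. 2 * pi * (?f \<theta> * indicator {0..pi} \<theta>) \<partial>lborel)"
    by (rule Bochner_Integration.integral_cong) (auto simp: indicator_times)
  also have "\<dots> = 2 * pi * (\<integral>\<theta>. ?f \<theta> * indicator {0..pi} \<theta> \<partial>lborel)"
    by (rule integral_mult_right_zero)
  also have "(\<integral>\<theta>. ?f \<theta> * indicator {0..pi} \<theta> \<partial>lborel) = ln (1 + \<epsilon> - cos pi) - ln (1 + \<epsilon> - cos 0)"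
  proof (rule integral_FTC_Icc_real)
    fix t :: real
    show "((\<lambda>t. ln (1 + \<epsilon> - cos t)) has_real_derivative ?f t) (at t)"
      using pos[of t] by (auto intro!: derivative_eq_intros)
    show "isCont ?f t"
      using pos[of t] by (intro continuous_intros) auto
  qed simp
  finally show ?thesis by simp
qed

text \<open>Along the cutoffs the mean and the mean square both tend to the mass q of the point,
  while the energy tends to zero. The variance inequality becomes q (m - q) \<le> 0 with m the total
  mass, and q = m is excluded by \<open>not_Dirac_S2\<close>.\<close>

lemma measure_singleton_S2:
  assumes M: "nonzero_radon_S2 M" and ev: "eigenvalue_S2 1 M = 2" and p: "p \<in> S2"
  shows "measure M {p} = 0"
proof -
  note M' = nonzero_radon_S2_D[OF M]
  interpret finite_measure M by (rule M'(3))
  define \<epsilon> where "\<epsilon> n = inverse (real (Suc n))" for n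
  define L where "L n = ln (2 + \<epsilon> n) - ln (\<epsilon> n)" for n
  \<comment> \<open>logarithmic cutoffs: \<open>u n\<close> is \<open>1\<close> at \<open>p\<close>, tends to \<open>0\<close> elsewhere, and has energy \<open>O(1 / L n)\<close>\<close>
  define u where "u n x = (ln (2 + \<epsilon> n) - ln (1 + \<epsilon> n - x \<bullet> p)) / L n" for n x
  have \<epsilon>: "\<epsilon> n > 0" for n by (simp add: \<epsilon>_def)
  have L: "L n > 0" for n unfolding L_def using \<epsilon>[of n] by (simp add: ln_less_cancel_iff)
  have xp: "x \<bullet> p \<le> 1" "- 1 \<le> x \<bullet> p" if "x \<in> S2" for x
    using Cauchy_Schwarz_ineq2[of x p] that p by auto
  have pos: "1 + \<epsilon> n - x \<bullet> p > 0" if "x \<in> S2" for n x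
    using xp[OF that] \<epsilon>[of n] by linarith
  have smooth_ln: "smooth_S2 (\<lambda>x. ln (1 + \<epsilon> n + (-1) * (x \<bullet> p)))" for n
  proof (rule smooth_S2_compose_Ck_on[OF _ _ Ck_on_ln])
    show "smooth_S2 (\<lambda>x. 1 + \<epsilon> n + (-1) * (x \<bullet> p))"
      by (intro smooth_S2_add smooth_S2_mult smooth_S2_inner smooth_S2_const smooth_S2_id)
    show "1 + \<epsilon> n + (-1) * (x \<bullet> p) \<in> {0<..}" if "x \<in> S2" for x
      using pos[OF that, of n] by simp
  qed simp
  \<comment> \<open>The affine form, with signs written as factors, fits
    \<open>smooth_S2_mult\<close> and \<open>dirichlet_energy_affine\<close>.\<close>
  have u_eq: "u n = (\<lambda>x. ln (2 + \<epsilon> n) / L n + (- 1 / L n) * ln (1 + \<epsilon> n + (-1) * (x \<bullet> p)))" for n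
    by (auto simp: u_def diff_divide_distrib)
  have smooth: "smooth_S2 (u n)" for n
    unfolding u_eq by (intro smooth_S2_add smooth_S2_mult smooth_S2_const smooth_ln)
  have u01: "0 \<le> u n x \<and> u n x \<le> 1" if "x \<in> S2" for n x
  proof -
    have "ln (\<epsilon> n) \<le> ln (1 + \<epsilon> n - x \<bullet> p)" "ln (1 + \<epsilon> n - x \<bullet> p) \<le> ln (2 + \<epsilon> n)"
      using xp[OF that] \<epsilon>[of n] by simp_all
    then show ?thesis
      using L[of n] by (simp add: u_def L_def divide_le_eq)
  qed
  have energy: "dirichlet_energy (u n) \<le> 4 * pi / L n" for n
  proof -
    have g: "(norm (grad_S2 (\<lambda>x. ln (1 + \<epsilon> n + (-1) * (x \<bullet> p))) x))\<^sup>2 \<le> 2 * (1 / (1 + \<epsilon> n - x \<bullet> p))"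
      if x: "x \<in> S2" for x
    proof -
      let ?s = "1 + \<epsilon> n - x \<bullet> p"
      have s: "?s > 0" by (rule pos[OF x])
      have "grad_S2 (\<lambda>x. ln (1 + \<epsilon> n + (-1) * (x \<bullet> p))) x = (- 1 / ?s) *\<^sub>R grad_S2 (\<lambda>x. x \<bullet> p) x"
        by (rule grad_S2_real_compose[where g = "\<lambda>t. ln (1 + \<epsilon> n + (-1) * t)"])
          (use s x in \<open>auto intro!: derivative_eq_intros smooth_S2_inner smooth_S2_id smooth_S2_const\<close>)
      then have "(norm (grad_S2 (\<lambda>x. ln (1 + \<epsilon> n + (-1) * (x \<bullet> p))) x))\<^sup>2
          = (norm (p - (x \<bullet> p) *\<^sub>R x))\<^sup>2 / ?s\<^sup>2"
        by (simp add: grad_S2_coordinate[OF x] power_divide)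
      also have "(norm (p - (x \<bullet> p) *\<^sub>R x))\<^sup>2 = (1 - x \<bullet> p) * (1 + x \<bullet> p)"
      proof -
        have "p \<bullet> p = 1" "x \<bullet> x = 1" using p x by (simp_all add: norm_eq_sqrt_inner)
        then show ?thesis
          unfolding power2_norm_eq_inner
          by (simp add: inner_diff_left inner_diff_right inner_commute algebra_simps)
      qed
      \<comment> \<open>Bounding one factor by \<open>?s\<close> and the other by 2 cancels one
        power of \<open>?s\<close>, leaving the integrand of
        \<open>area_S2_integral_log\<close>.\<close>
      also have "(1 - x \<bullet> p) * (1 + x \<bullet> p) / ?s\<^sup>2 \<le> ?s * 2 / ?s\<^sup>2"
        using xp[OF x] \<epsilon>[of n] by (intro divide_right_mono mult_mono) auto
      also have "\<dots> = 2 * (1 / ?s)"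
        using s by (simp only: power2_eq_square divide_simps split: if_splits) simp
      finally show ?thesis .
    qed
    have int: "integrable area_S2 (\<lambda>x. 2 * (1 / (1 + \<epsilon> n - x \<bullet> p)))"
    proof (intro integrable_area_S2 continuous_intros ballI)
      fix x assume "x \<in> S2"
      from pos[OF this, of n] show "1 + \<epsilon> n - x \<bullet> p \<noteq> 0" by simp
    qed
    have "dirichlet_energy (\<lambda>x. ln (1 + \<epsilon> n + (-1) * (x \<bullet> p))) \<le> (\<integral>x. 2 * (1 / (1 + \<epsilon> n - x \<bullet> p)) \<partial>area_S2)"
      unfolding dirichlet_energy_def
      using integrable_area_S2[OF continuous_on_norm_grad_S2[OF smooth_ln]] int
      by (rule integral_mono) (use g in \<open>simp only: space_area_S2\<close>)
    also have "\<dots> = 2 * (\<integral>x. 1 / (1 + \<epsilon> n - x \<bullet> p) \<partial>area_S2)"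
      by (rule integral_mult_right_zero)
    also have "\<dots> = 4 * pi * L n"
      using area_S2_integral_log[OF \<epsilon>[of n] p] by (simp add: L_def)
    finally have "dirichlet_energy (u n) \<le> (- 1 / L n)\<^sup>2 * (4 * pi * L n)"
      unfolding u_eq dirichlet_energy_affine[OF smooth_ln] by (rule mult_left_mono) simp
    then show ?thesis using L[of n] by (simp add: power2_eq_square)
  qed
  have L_lim: "filterlim L at_top sequentially"
  proof (rule filterlim_at_top_mono)
    show "filterlim (\<lambda>n. ln (real (Suc n))) at_top sequentially"
      by (rule filterlim_compose[OF ln_at_top])
        (rule filterlim_compose[OF filterlim_real_sequentially filterlim_Suc])
    have "ln (real (Suc n)) \<le> L n" for n
    proof -
      have "ln (\<epsilon> n) = - ln (real (Suc n))" by (simp add: \<epsilon>_def ln_inverse)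
      moreover have "0 \<le> ln (2 + \<epsilon> n)" using \<epsilon>[of n] by simp
      ultimately show ?thesis by (simp add: L_def)
    qed
    then show "\<forall>\<^sub>F n in sequentially. ln (real (Suc n)) \<le> L n" by simp
  qed
  have \<epsilon>_lim: "\<epsilon> \<longlonglongrightarrow> 0"
    unfolding \<epsilon>_def[abs_def] by (rule LIMSEQ_inverse_real_of_nat)
  have u_lim: "(\<lambda>n. u n x) \<longlonglongrightarrow> indicator {p} x" if x: "x \<in> S2" for x
  proof (cases "x = p")
    case True
    have "p \<bullet> p = 1" using p by (simp add: norm_eq_sqrt_inner)
    then have "u n x = 1" for n using L[of n] True by (simp add: u_def L_def)
    then show ?thesis using True by simp
  next
    case False
    have "x \<bullet> p \<noteq> 1"
    proof
      assume "x \<bullet> p = 1"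
      moreover have "p \<bullet> p = 1" "x \<bullet> x = 1" using p x by (simp_all add: norm_eq_sqrt_inner)
      ultimately have "(x - p) \<bullet> (x - p) = 0"
        by (simp add: inner_diff_left inner_diff_right inner_commute)
      then show False using False by simp
    qed
    then have "1 - x \<bullet> p > 0" using xp[OF x] by simp
    then have "(\<lambda>n. ln (2 + \<epsilon> n) - ln (1 + \<epsilon> n - x \<bullet> p)) \<longlonglongrightarrow> ln (2 + 0) - ln (1 + 0 - x \<bullet> p)"
      by (intro tendsto_intros \<epsilon>_lim) auto
    then have "(\<lambda>n. u n x) \<longlonglongrightarrow> 0"
      unfolding u_def by (rule tendsto_divide_0[OF _ filterlim_at_top_imp_at_infinity[OF L_lim]])
    then show ?thesis using False by simp
  qed
  have pM: "{p} \<in> sets M"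
    unfolding M'(1) using p by (auto simp: sets_restrict_space_iff)
  have meas: "u n \<in> borel_measurable M" for n
    using integrable_continuous_on_S2[OF M'(1,3) smooth_S2_continuous_on[OF smooth]] by simp
  have lim1: "(\<lambda>n. \<integral>x. u n x \<partial>M) \<longlonglongrightarrow> (\<integral>x. indicator {p} x \<partial>M)"
  proof (rule integral_dominated_convergence[where w = "\<lambda>x. 1"])
    show "AE x in M. (\<lambda>n. u n x) \<longlonglongrightarrow> indicator {p} x"
      using u_lim M'(2) by (intro AE_I2) auto
    show "AE x in M. norm (u n x) \<le> 1" for n
      using u01 M'(2) by (intro AE_I2) auto
  qed (use pM meas in auto)
  have lim2: "(\<lambda>n. \<integral>x. (u n x)\<^sup>2 \<partial>M) \<longlonglongrightarrow> (\<integral>x. (indicator {p} x)\<^sup>2 \<partial>M)"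
  proof (rule integral_dominated_convergence[where w = "\<lambda>x. 1"])
    show "AE x in M. (\<lambda>n. (u n x)\<^sup>2) \<longlonglongrightarrow> (indicator {p} x)\<^sup>2"
      using u_lim M'(2) by (intro AE_I2) (auto intro!: tendsto_power)
    show "AE x in M. norm ((u n x)\<^sup>2) \<le> 1" for n
      using u01 M'(2) by (intro AE_I2) (auto intro!: power_le_one)
  qed (use pM meas in auto)
  let ?q = "measure M {p}" and ?m = "measure M S2"
  have int: "(\<integral>x. indicator {p} x \<partial>M) = ?q" "(\<integral>x. (indicator {p} x)\<^sup>2 \<partial>M) = ?q"
  proof -
    show "(\<integral>x. indicator {p} x \<partial>M) = ?q" using pM by simp
    moreover have "(indicator {p} x)\<^sup>2 = (indicator {p} x :: real)" for x
      by (simp add: indicator_def)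
    ultimately show "(\<integral>x. (indicator {p} x)\<^sup>2 \<partial>M) = ?q" by simp
  qed
  have "2 * (?q - ?q\<^sup>2 / ?m) \<le> 0"
  proof (rule LIMSEQ_le)
    show "(\<lambda>n. 2 * ((\<integral>x. (u n x)\<^sup>2 \<partial>M) - (\<integral>x. u n x \<partial>M)\<^sup>2 / ?m)) \<longlonglongrightarrow> 2 * (?q - ?q\<^sup>2 / ?m)"
      using lim1 lim2 M'(4) unfolding int by (intro tendsto_intros) auto
    show "(\<lambda>n. 4 * pi / L n) \<longlonglongrightarrow> 0"
      by (rule tendsto_divide_0[OF tendsto_const filterlim_at_top_imp_at_infinity[OF L_lim]])
    show "\<exists>N. \<forall>n\<ge>N. 2 * ((\<integral>x. (u n x)\<^sup>2 \<partial>M) - (\<integral>x. u n x \<partial>M)\<^sup>2 / ?m) \<le> 4 * pi / L n"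
      using dirichlet_energy_ge_variance[OF M ev smooth] energy order_trans by blast
  qed
  then have "?q * (?m - ?q) \<le> 0"
    using M'(4) by (simp add: field_simps power2_eq_square)
  moreover have "?q < ?m"
  proof -
    have "?q \<le> ?m" using finite_measure_mono[of "{p}" S2] p M'(1,2) sets.top[of M] by simp
    then show ?thesis using not_Dirac_S2[OF M _ p] ev by fastforce
  qed
  ultimately have "?q \<le> 0" by (simp add: mult_le_0_iff)
  then show ?thesis by (simp add: measure_le_0_iff)
qed

text \<open>The centre of mass \<open>H\<close> is a continuous vector field on the closed ball of
  parameters and points outward on its boundary. If it had no zero, Brouwer's theorem for the
  normalised field - H / |H| would give a contradiction.\<close>

lemma Hersch:
  assumes M: "nonzero_radon_S2 M" and atoms: "\<And>p. p \<in> S2 \<Longrightarrow> measure M {p} = 0"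
  obtains a where "norm a < 1" "(\<integral>x. moebius_map a x \<partial>M) = 0"
proof (rule ccontr)
  note M' = nonzero_radon_S2_D[OF M]
  interpret finite_measure M by (rule M'(3))
  assume "\<not> thesis"
  define H where "H a = (\<integral>x. moebius_map a x \<partial>M)" for a
  have H_nz: "H a \<noteq> 0" if "norm a < 1" for a
    using that \<open>\<not> thesis\<close> \<open>\<And>a. norm a < 1 \<Longrightarrow> (\<integral>x. moebius_map a x \<partial>M) = 0 \<Longrightarrow> thesis\<close>
    unfolding H_def by blast
  have bd: "moebius_map a x = a" if "norm a = 1" for a x :: "real ^ 3"
    using that by (simp add: moebius_map_def flip: power2_norm_eq_inner)
  have H_bd: "H a = measure M S2 *\<^sub>R a" if "norm a = 1" for a
    using M'(2) by (simp add: H_def bd[OF that])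
  have nz: "H a \<noteq> 0" if "a \<in> cball 0 1" for a
    using that H_nz[of a] H_bd[of a] M'(4) by (cases "norm a = 1") auto
  have bound: "norm (moebius_map a x) \<le> 1" if "norm a \<le> 1" "x \<in> S2" for a x
  proof (cases "x + a = 0")
    case True
    then show ?thesis using that(1) by (simp add: moebius_map_def)
  next
    case False
    then show ?thesis using norm_moebius[of x a] that by simp
  qed
  have meas: "moebius_map a \<in> borel_measurable M" if "norm a \<le> 1" for a
  proof (cases "norm a = 1")
    case True
    then have "moebius_map a = (\<lambda>x. a)" using bd by blast
    then show ?thesis by simp
  next
    case False
    then have "smooth_S2 (moebius_map a)" using that by (intro smooth_S2_moebius) simp
    then show ?thesis
      by (rule borel_measurable_integrable[OF integrable_continuous_on_S2[OF M'(1,3) smooth_S2_continuous_on]])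
  qed
  have cont: "continuous_on (cball 0 1) H"
    unfolding continuous_on_sequentially
  proof (intro allI ballI impI, elim conjE)
    fix a and s :: "nat \<Rightarrow> real ^ 3"
    assume a: "a \<in> cball 0 1" and s: "\<forall>n. s n \<in> cball 0 1" "s \<longlonglongrightarrow> a"
    \<comment> \<open>For fixed \<open>x\<close> the map is continuous in the parameter except at
      \<open>a = - x\<close>. Absence of atoms makes this point negligible when \<open>a\<close> is
      on the boundary; for interior \<open>a\<close> it is not on the sphere.\<close>
    have "AE x in M. x \<noteq> - a"
    proof (cases "- a \<in> S2")
      case True
      then have "{- a} \<in> sets M" unfolding M'(1) by (auto simp: sets_restrict_space_iff)
      then have "{- a} \<in> null_sets M"
        using atoms[OF True] by (simp add: null_sets_def emeasure_eq_measure)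
      then show ?thesis by (rule AE_I') auto
    next
      case False
      then show ?thesis using M'(2) by (intro AE_I2) auto
    qed
    then have "AE x in M. (\<lambda>n. moebius_map (s n) x) \<longlonglongrightarrow> moebius_map a x"
    proof eventually_elim
      case (elim x)
      then have "x + a \<noteq> 0" by (simp add: eq_neg_iff_add_eq_0)
      then have "(x + a) \<bullet> (x + a) \<noteq> 0" by simp
      then show ?case
        unfolding moebius_map_def by (intro tendsto_intros s(2))
    qed
    then show "(H \<circ> s) \<longlonglongrightarrow> H a"
      unfolding H_def[abs_def] o_def
      by (intro integral_dominated_convergence[where w = "\<lambda>x. 1"])
        (use a s(1) bound meas M'(2) in \<open>auto intro!: AE_I2\<close>)
  qed
  \<comment> \<open>\<open>H\<close> is a positive multiple of the identity on the boundary, so \<open>G\<close> is antipodal there and a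
    fixed point of \<open>G\<close> is impossible\<close>
  define G where "G a = - (H a /\<^sub>R norm (H a))" for a
  have "continuous_on (cball 0 1) G"
    unfolding G_def[abs_def] using nz by (intro continuous_intros cont) auto
  moreover have normG: "norm (G a) = 1" if "a \<in> cball 0 1" for a
    using nz[OF that] by (simp add: G_def)
  then have "G \<in> cball 0 1 \<rightarrow> cball 0 1" by auto
  ultimately obtain a where a: "a \<in> cball 0 1" "G a = a"
    using brouwer_ball[of 1 0 G] by auto
  then have na: "norm a = 1" using normG[OF a(1)] by simp
  then have "G a = - a"
    using M'(4) by (simp add: G_def H_bd)
  then have "a = - a" using a(2) by simp
  from arg_cong[OF this, of "\<lambda>v. v \<bullet> a"] have "a = 0" by simp
  then show False using na by simp
qed

section \<open>The stability estimate\<close>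

lemma sum_dirichlet_energy_coordinate_mult:
  assumes h: "smooth_S2 h"
  shows "(\<Sum>e\<in>Basis. dirichlet_energy (\<lambda>x. (x \<bullet> e) * h x))
    = dirichlet_energy h + 2 * (\<integral>x. (h x)\<^sup>2 \<partial>area_S2)"
proof -
  have sm: "smooth_S2 (\<lambda>x. (x \<bullet> e) * h x)" for e
    by (intro smooth_S2_mult smooth_S2_inner smooth_S2_id smooth_S2_const h)
  have "(\<Sum>e\<in>Basis. dirichlet_energy (\<lambda>x. (x \<bullet> e) * h x))
      = (\<integral>x. (\<Sum>e\<in>Basis. (norm (grad_S2 (\<lambda>x. (x \<bullet> e) * h x) x))\<^sup>2) \<partial>area_S2)"
    unfolding dirichlet_energy_def
    by (rule Bochner_Integration.integral_sum[symmetric])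
      (rule integrable_area_S2[OF continuous_on_norm_grad_S2[OF sm]])
  also have "\<dots> = (\<integral>x. (norm (grad_S2 h x))\<^sup>2 + 2 * (h x)\<^sup>2 \<partial>area_S2)"
    by (rule Bochner_Integration.integral_cong)
      (simp_all only: space_area_S2 sum_norm_grad_S2_coordinate_mult[OF h])
  also have "\<dots> = (\<integral>x. (norm (grad_S2 h x))\<^sup>2 \<partial>area_S2) + (\<integral>x. 2 * (h x)\<^sup>2 \<partial>area_S2)"
    by (intro Bochner_Integration.integral_add integrable_area_S2 continuous_on_norm_grad_S2 h
        continuous_intros smooth_S2_continuous_on)
  finally show ?thesis
    by (simp add: dirichlet_energy_def)
qed

lemma W12_norm_jet:
  assumes "smooth_S2 f"
  shows "(W12_norm (jet f))\<^sup>2 = dirichlet_energy f + (\<integral>x. (f x)\<^sup>2 \<partial>area_S2)"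
proof -
  have "(W12_norm (jet f))\<^sup>2 = (\<integral>x. (norm (grad_S2 f x))\<^sup>2 + (f x)\<^sup>2 \<partial>area_S2)"
    by (simp add: W12_norm_def jet_def)
  also have "\<dots> = dirichlet_energy f + (\<integral>x. (f x)\<^sup>2 \<partial>area_S2)"
    unfolding dirichlet_energy_def
    by (intro Bochner_Integration.integral_add integrable_area_S2 continuous_on_norm_grad_S2 assms
        continuous_intros smooth_S2_continuous_on)
  finally show ?thesis .
qed

lemma dual_norm_bound:
  assumes M: "nonzero_radon_S2 M" and ev: "eigenvalue_S2 1 M = 2"
    and a: "norm a < 1" and bal: "(\<integral>x. moebius_map a x \<partial>M) = 0"
    and f: "smooth_S2 f" "W12_norm (jet f) = 1"
  defines "d \<equiv> (\<integral>x. f x \<partial>pushforward_S2 (moebius_map a) M) - (\<integral>x. f x \<partial>area_S2)"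
  shows "d\<^sup>2 \<le> 4 * pi - measure M S2"
proof -
  note M' = nonzero_radon_S2_D[OF M]
  let ?m = "measure M S2" and ?\<Phi> = "moebius_map a"
  let ?F = "\<lambda>x. f (?\<Phi> x)" and ?h = "\<lambda>x. 1 + d * f x"
  have cf: "continuous_on S2 f" by (rule smooth_S2_continuous_on[OF f(1)])
  have c\<Phi>: "continuous_on S2 ?\<Phi>" by (rule smooth_S2_continuous_on[OF smooth_S2_moebius[OF a]])
  have cF: "continuous_on S2 ?F"
    by (rule smooth_S2_continuous_on[OF smooth_S2_compose[OF f(1) smooth_S2_moebius[OF a] moebius_in_S2[OF a]]])
  note int = integrable_continuous_on_S2[OF M'(1,3)]
  have d: "d = (\<integral>x. ?F x \<partial>M) - (\<integral>x. f x \<partial>area_S2)"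
  proof -
    have "?\<Phi> \<in> measurable M borel_S2"
      using moebius_in_S2[OF a] borel_measurable_integrable[OF int[OF c\<Phi>]] M'(2)
      by (intro measurable_restrict_space2) auto
    then show ?thesis
      unfolding d_def pushforward_S2_def
      by (simp add: integral_distr[OF _ continuous_on_S2_measurable[OF cf]])
  qed
  have h: "smooth_S2 ?h"
    by (intro smooth_S2_add smooth_S2_mult smooth_S2_const f)
  define w where "w e x = (?\<Phi> x \<bullet> e) * ?F x" for e x
  have cw: "continuous_on S2 (w e)" for e
    unfolding w_def by (intro continuous_intros c\<Phi> cF)
  have parseval: "(\<Sum>e\<in>Basis. (?\<Phi> x \<bullet> e)\<^sup>2) = 1" if "x \<in> S2" for x
    using euclidean_inner[of "?\<Phi> x" "?\<Phi> x"] moebius_in_S2[OF a that]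
    by (simp add: power2_eq_square norm_eq_sqrt_inner)
  have sum_sq: "(\<Sum>e\<in>Basis. \<integral>x. ((?\<Phi> x \<bullet> e) * g x)\<^sup>2 \<partial>M) = (\<integral>x. (g x)\<^sup>2 \<partial>M)"
    if g: "continuous_on S2 g" for g :: "real ^ 3 \<Rightarrow> real"
  proof -
    have "(\<Sum>e\<in>Basis. \<integral>x. ((?\<Phi> x \<bullet> e) * g x)\<^sup>2 \<partial>M) = (\<integral>x. (\<Sum>e\<in>Basis. ((?\<Phi> x \<bullet> e) * g x)\<^sup>2) \<partial>M)"
      by (rule Bochner_Integration.integral_sum[symmetric]) (intro int continuous_intros c\<Phi> g)
    also have "\<dots> = (\<integral>x. (g x)\<^sup>2 \<partial>M)"
      by (rule Bochner_Integration.integral_cong)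
        (simp_all add: M'(2) power_mult_distrib parseval flip: sum_distrib_right)
    finally show ?thesis .
  qed
  have bal_e: "(\<integral>x. ?\<Phi> x \<bullet> e \<partial>M) = 0" for e
    using integral_inner_left[OF int[OF c\<Phi>], of e] bal by simp
  \<comment> \<open>By balance the summand 1 of \<open>?h\<close> drops out of the mean, and
    Cauchy-Schwarz bounds the rest. Summed over \<open>e\<close>, the subtracted terms give the
    integral of \<open>d\<^sup>2 * (?F x)\<^sup>2\<close>, exactly what the expansion of
    \<open>?h\<^sup>2\<close> produces.\<close>
  have var: "2 * (\<integral>x. ((?\<Phi> x \<bullet> e) * ?h (?\<Phi> x))\<^sup>2 \<partial>M) - 2 * d\<^sup>2 * (\<integral>x. (w e x)\<^sup>2 \<partial>M)
      \<le> dirichlet_energy (\<lambda>x. (x \<bullet> e) * ?h x)" for e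
  proof -
    let ?v = "\<lambda>x. (x \<bullet> e) * ?h x"
    have v: "smooth_S2 ?v"
      by (intro smooth_S2_mult smooth_S2_inner smooth_S2_id smooth_S2_const h)
    have "(\<integral>x. ?v (?\<Phi> x) \<partial>M) = (\<integral>x. (?\<Phi> x \<bullet> e) + d * w e x \<partial>M)"
      by (simp add: w_def algebra_simps)
    also have "\<dots> = d * (\<integral>x. w e x \<partial>M)"
      using bal_e[of e] integrable_mult_right[OF int[OF cw[of e]], of d]
        int[OF continuous_on_inner[OF c\<Phi> continuous_on_const]]
      by (subst Bochner_Integration.integral_add) auto
    finally have mean: "(\<integral>x. ?v (?\<Phi> x) \<partial>M) = d * (\<integral>x. w e x \<partial>M)" .
    have "(\<integral>x. w e x \<partial>M)\<^sup>2 / ?m \<le> (\<integral>x. (w e x)\<^sup>2 \<partial>M)"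
      using square_integral_le[OF M'(3) _ int[OF cw[of e]] int[OF continuous_on_power[OF cw[of e]]]] M'(2,4)
      by simp
    then have "d\<^sup>2 * ((\<integral>x. w e x \<partial>M)\<^sup>2 / ?m) \<le> d\<^sup>2 * (\<integral>x. (w e x)\<^sup>2 \<partial>M)"
      by (rule mult_left_mono) simp
    moreover have "2 * ((\<integral>x. (?v (?\<Phi> x))\<^sup>2 \<partial>M) - d\<^sup>2 * ((\<integral>x. w e x \<partial>M)\<^sup>2 / ?m))
        \<le> dirichlet_energy ?v"
      using dirichlet_energy_ge_variance[OF M ev smooth_S2_compose[OF v smooth_S2_moebius[OF a] moebius_in_S2[OF a]]]
      by (simp add: mean dirichlet_energy_moebius[OF a v] power_mult_distrib)
    ultimately show ?thesis by simp
  qed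
  have "2 * (\<integral>x. (?h (?\<Phi> x))\<^sup>2 \<partial>M) - 2 * d\<^sup>2 * (\<integral>x. (?F x)\<^sup>2 \<partial>M)
      \<le> dirichlet_energy ?h + 2 * (\<integral>x. (?h x)\<^sup>2 \<partial>area_S2)"
  proof -
    have "(\<Sum>e\<in>Basis. 2 * (\<integral>x. ((?\<Phi> x \<bullet> e) * ?h (?\<Phi> x))\<^sup>2 \<partial>M) - 2 * d\<^sup>2 * (\<integral>x. (w e x)\<^sup>2 \<partial>M))
        \<le> (\<Sum>e\<in>Basis. dirichlet_energy (\<lambda>x. (x \<bullet> e) * ?h x))"
      by (rule sum_mono) (rule var)
    then show ?thesis
      using sum_sq[OF cF] sum_sq[of "\<lambda>x. ?h (?\<Phi> x)"] cF
      by (simp add: sum_subtractf sum_dirichlet_energy_coordinate_mult[OF h] w_def continuous_intros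
          flip: sum_distrib_left)
  qed
  moreover have "(\<integral>x. (?h (?\<Phi> x))\<^sup>2 \<partial>M) = ?m + 2 * d * (\<integral>x. ?F x \<partial>M) + d\<^sup>2 * (\<integral>x. (?F x)\<^sup>2 \<partial>M)"
    using integral_square_affine[OF M'(3) _ int[OF cF] int[OF continuous_on_power[OF cF]], of 1 d] M'(2,4)
    by simp
  moreover have "(\<integral>x. (?h x)\<^sup>2 \<partial>area_S2)
      = 4 * pi + 2 * d * (\<integral>x. f x \<partial>area_S2) + d\<^sup>2 * (\<integral>x. (f x)\<^sup>2 \<partial>area_S2)"
    using integral_square_affine[OF finite_measure_area_S2 _ integrable_area_S2[OF cf]
        integrable_area_S2[OF continuous_on_power[OF cf]], of 1 d]
    by (simp add: space_area_S2 measure_area_S2)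
  moreover have "dirichlet_energy ?h = d\<^sup>2 * dirichlet_energy f"
    by (rule dirichlet_energy_affine[OF f(1)])
  \<comment> \<open>The energy enters once and the square integral twice, so together they are at
    most twice the squared norm.\<close>
  moreover have "dirichlet_energy f + (\<integral>x. (f x)\<^sup>2 \<partial>area_S2) = 1"
    using W12_norm_jet[OF f(1)] f(2) by simp
  then have "d\<^sup>2 * (dirichlet_energy f + 2 * (\<integral>x. (f x)\<^sup>2 \<partial>area_S2)) \<le> d\<^sup>2 * 2"
    using dirichlet_energy_nonneg[of f] by (intro mult_left_mono) auto
  moreover have "d * (\<integral>x. ?F x \<partial>M) = d * (\<integral>x. f x \<partial>area_S2) + d\<^sup>2"
    by (simp add: d power2_eq_square algebra_simps)
  ultimately show ?thesis
    by (simp add: algebra_simps)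
qed

theorem theorem1p2:
  fixes M :: "(real ^ 3) measure"
  assumes "admissible M"
    and "eigenvalue_S2 1 M = 2"
  shows "\<exists>\<Phi>. conformal_automorphism \<Phi> \<and>
    ereal (8 * pi) - normalized_eigenvalue_S2 1 M \<ge>
      2 * (dual_norm_diff (pushforward_S2 \<Phi> M) area_S2)\<^sup>2"
proof -
  have M: "nonzero_radon_S2 M"
    using assms(1) by (simp add: admissible_def)
  obtain a where a: "norm a < 1" "(\<integral>x. moebius_map a x \<partial>M) = 0"
    using Hersch[OF M measure_singleton_S2[OF M assms(2)]] by blast
  let ?D = "dual_norm_diff (pushforward_S2 (moebius_map a) M) area_S2"
  let ?d = "\<lambda>f. (\<integral>x. f x \<partial>pushforward_S2 (moebius_map a) M) - (\<integral>x. f x \<partial>area_S2)"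
  let ?c = "sqrt (4 * pi - measure M S2)"
  have bound: "\<bar>?d f\<bar> \<le> ?c" if "smooth_S2 f" "W12_norm (jet f) = 1" for f
    using dual_norm_bound[OF M assms(2) a that] by (rule real_le_rsqrt[OF order.trans[OF eq_refl], rotated]) simp
  \<comment> \<open>A constant of norm one, the area being 4 \<pi>. It shows that the supremum is
    not taken over the empty set; otherwise its value would be minus infinity, with infinite
    square.\<close>
  define f0 where "f0 = (\<lambda>x :: real ^ 3. 1 / sqrt (4 * pi))"
  have f0: "smooth_S2 f0" "W12_norm (jet f0) = 1"
  proof -
    show sm: "smooth_S2 f0" unfolding f0_def by (rule smooth_S2_const)
    have "dirichlet_energy f0 = 0"
      unfolding dirichlet_energy_def f0_def by (simp add: grad_S2_const)
    moreover have "(\<integral>x. (f0 x)\<^sup>2 \<partial>area_S2) = 1"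
      by (simp add: f0_def space_area_S2 measure_area_S2 power_divide)
    ultimately have "(W12_norm (jet f0))\<^sup>2 = 1"
      by (simp add: W12_norm_jet[OF sm])
    moreover have "W12_norm (jet f0) \<ge> 0"
      by (simp add: W12_norm_def jet_def)
    ultimately show "W12_norm (jet f0) = 1"
      by (simp add: power2_eq_1_iff)
  qed
  have "?D \<le> ereal ?c"
    unfolding dual_norm_diff_def
    by (rule SUP_least) (use bound in \<open>auto simp: abs_le_iff\<close>)
  moreover have "ereal (- ?c) \<le> ?D"
  proof -
    have "ereal (- ?c) \<le> ereal (?d f0)"
      using bound[OF f0] by (simp add: abs_le_iff)
    also have "\<dots> \<le> ?D"
      unfolding dual_norm_diff_def by (rule SUP_upper) (use f0 in simp)
    finally show ?thesis .
  qed
  ultimately obtain r where r: "?D = ereal r" "\<bar>r\<bar> \<le> ?c"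
    by (cases ?D) (auto simp: abs_le_iff)
  have "r\<^sup>2 \<le> 4 * pi - measure M S2"
    using r(2) by (rule sqrt_ge_absD)
  then have "2 * (ereal r)\<^sup>2 \<le> ereal (8 * pi) - 2 * ereal (measure M S2)"
    by (simp add: power2_eq_square)
  then show ?thesis
    using conformal_automorphism_moebius[OF a(1)] r(1) assms(2)
    by (intro exI[of _ "moebius_map a"]) (simp add: normalized_eigenvalue_S2_def)
qed

end
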